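(* Let $\tau > \omega$ be a cardinal. Then the correspondence $\lambda \colon {\mathcal C}_{p}({\mathcal Z}_{\tau}) \to {\mathcal Z}_{\tau}$, defined by letting: (i) for an object $I^{\tau}\setminus X$ of ${\mathcal C}_{p}({\mathcal Z}_{\tau})$, $\lambda (I^{\tau}\setminus X) = X$; (ii) for a morphism $\{ g\} \colon I^{\tau}\setminus X \to I^{\tau}\setminus Y$ of ${\mathcal C}_{p}({\mathcal Z}_{\tau})$, $\lambda(\{ g\} ) = \widetilde{g}|X$, is an isomorphism of categories.
   Context: $I=[0,1]$; a map (continuous) is proper if preimages of compact sets are compact. ${\mathcal Z}_\tau$ is the category of $Z_\tau$-sets of the cube $I^\tau$ and their continuous maps. For $\tau>\omega$ and a $Z_\tau$-set $X\subset I^\tau$, $I^\tau$ is the Stone-Čech compactification of $I^\tau\setminus X$, so a proper map $g\colon I^\tau\setminus X\to I^\tau\setminus Y$ has a unique extension $\widetilde g\colon I^\tau\to I^\tau$, and $\widetilde g(X)\subset Y$. Two proper maps $g_1,g_2\colon I^\tau\setminus X\to I^\tau\setminus Y$ are close (in the coarse structure continuously controlled by $I^\tau$) if $\widetilde g_1(x)=\widetilde g_2(x)$ for every $x\in X$; $\{g\}$ denotes the closeness class of $g$. ${\mathcal C}_p({\mathcal Z}_\tau)$ is the category whose objects are the complements $I^\tau\setminus X$ of $Z_\tau$-sets $X$ in $I^\tau$ and whose morphisms are closeness classes $\{g\}$ of proper maps. $Z_\tau$-sets: for a Tychonov space $Y$ let $\operatorname{cov}(Y)$ be the collection of all countable covers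 of $Y$ by functionally open (cozero) sets. Maps $f,g\colon X\to Y$ are ${\mathcal U}$-close if for each $x\in X$ some $U\in{\mathcal U}$ contains both $f(x)$ and $g(x)$. $C_\tau(X,Y)$ is the set of continuous maps $X\to Y$ with the topology in which $G$ is open iff for each $h\in G$ there is a family $\{{\mathcal U}_t\colon t\in T\}\subseteq\operatorname{cov}(Y)$ with $|T|<\tau$ such that every $g$ that is ${\mathcal U}_t$-close to $h$ for all $t\in T$ belongs to $G$. A closed subset $A\subset X$ is a $Z_\tau$-set in $X$ if $\{f\in C_\tau(X,X)\colon f(X)\cap A=\emptyset\}$ is dense in $C_\tau(X,X)$. *)

theory Defs
  imports "HOL-Analysis.Analysis"
begin

unbundle cardinal_syntax

section \<open>Categories and isomorphisms of categories\<close>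

text \<open>
  Hom-sets are indexed by source and target and need not be disjoint, so composition and
  the action of a functor on morphisms take the objects involved as arguments:
  \<open>cat_comp C a b c g f\<close> is the composite of \<open>f : a \<rightarrow> b\<close> and \<open>g : b \<rightarrow> c\<close>.
\<close>

record ('o, 'm) cat =
  cat_obj :: "'o set"
  cat_hom :: "'o \<Rightarrow> 'o \<Rightarrow> 'm set"
  cat_id :: "'o \<Rightarrow> 'm"
  cat_comp :: "'o \<Rightarrow> 'o \<Rightarrow> 'o \<Rightarrow> 'm \<Rightarrow> 'm \<Rightarrow> 'm"

definition is_category :: "('o, 'm) cat \<Rightarrow> bool" where
  "is_category C \<longleftrightarrow>
     (\<forall>a\<in>cat_obj C. cat_id C a \<in> cat_hom C a a) \<and>
     (\<forall>a\<in>cat_obj C. \<forall>b\<in>cat_obj C. \<forall>c\<in>cat_obj C. \<forall>f\<in>cat_hom C a b. \<forall>g\<in>cat_hom C b c.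
        cat_comp C a b c g f \<in> cat_hom C a c) \<and>
     (\<forall>a\<in>cat_obj C. \<forall>b\<in>cat_obj C. \<forall>f\<in>cat_hom C a b.
        cat_comp C a a b f (cat_id C a) = f \<and> cat_comp C a b b (cat_id C b) f = f) \<and>
     (\<forall>a\<in>cat_obj C. \<forall>b\<in>cat_obj C. \<forall>c\<in>cat_obj C. \<forall>d\<in>cat_obj C.
        \<forall>f\<in>cat_hom C a b. \<forall>g\<in>cat_hom C b c. \<forall>h\<in>cat_hom C c d.
        cat_comp C a c d h (cat_comp C a b c g f) = cat_comp C a b d (cat_comp C b c d h g) f)"

definition is_functor ::
  "('o, 'm) cat \<Rightarrow> ('p, 'n) cat \<Rightarrow> ('o \<Rightarrow> 'p) \<Rightarrow> ('o \<Rightarrow> 'o \<Rightarrow> 'm \<Rightarrow> 'n) \<Rightarrow> bool" where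
  "is_functor C D Fo Fm \<longleftrightarrow>
     is_category C \<and> is_category D \<and>
     (\<forall>a\<in>cat_obj C. Fo a \<in> cat_obj D) \<and>
     (\<forall>a\<in>cat_obj C. \<forall>b\<in>cat_obj C. \<forall>f\<in>cat_hom C a b. Fm a b f \<in> cat_hom D (Fo a) (Fo b)) \<and>
     (\<forall>a\<in>cat_obj C. Fm a a (cat_id C a) = cat_id D (Fo a)) \<and>
     (\<forall>a\<in>cat_obj C. \<forall>b\<in>cat_obj C. \<forall>c\<in>cat_obj C. \<forall>f\<in>cat_hom C a b. \<forall>g\<in>cat_hom C b c.
        Fm a c (cat_comp C a b c g f) = cat_comp D (Fo a) (Fo b) (Fo c) (Fm b c g) (Fm a b f))"

definition is_category_isomorphism ::
  "('o, 'm) cat \<Rightarrow> ('p, 'n) cat \<Rightarrow> ('o \<Rightarrow> 'p) \<Rightarrow> ('o \<Rightarrow> 'o \<Rightarrow> 'm \<Rightarrow> 'n) \<Rightarrow> bool" where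
  "is_category_isomorphism C D Fo Fm \<longleftrightarrow>
     is_functor C D Fo Fm \<and>
     (\<exists>Go Gm. is_functor D C Go Gm \<and>
        (\<forall>a\<in>cat_obj C. Go (Fo a) = a) \<and>
        (\<forall>x\<in>cat_obj D. Fo (Go x) = x) \<and>
        (\<forall>a\<in>cat_obj C. \<forall>b\<in>cat_obj C. \<forall>f\<in>cat_hom C a b. Gm (Fo a) (Fo b) (Fm a b f) = f) \<and>
        (\<forall>x\<in>cat_obj D. \<forall>y\<in>cat_obj D. \<forall>u\<in>cat_hom D x y. Fm (Go x) (Go y) (Gm x y u) = u))"

section \<open>Continuous maps as extensional functions\<close>

definition cmaps :: "'a topology \<Rightarrow> 'b topology \<Rightarrow> ('a \<Rightarrow> 'b) set" where
  "cmaps X Y = {f \<in> extensional (topspace X). continuous_map X Y f}"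

section \<open>The topology of \<open>C\<^sub>\<tau>(X, Y)\<close> and \<open>Z\<^sub>\<tau>\<close>-sets\<close>

definition functionally_open :: "'a topology \<Rightarrow> 'a set \<Rightarrow> bool" where
  "functionally_open Y U \<longleftrightarrow>
     (\<exists>\<phi>. continuous_map Y euclideanreal \<phi> \<and> U = {y \<in> topspace Y. \<phi> y \<noteq> 0})"

definition cov :: "'a topology \<Rightarrow> 'a set set set" where
  "cov Y = {\<U>. countable \<U> \<and> (\<forall>U\<in>\<U>. functionally_open Y U) \<and> \<Union>\<U> = topspace Y}"

definition cover_close :: "'a topology \<Rightarrow> 'b set set \<Rightarrow> ('a \<Rightarrow> 'b) \<Rightarrow> ('a \<Rightarrow> 'b) \<Rightarrow> bool" where
  "cover_close X \<U> f g \<longleftrightarrow> (\<forall>x\<in>topspace X. \<exists>U\<in>\<U>. f x \<in> U \<and> g x \<in> U)"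

text \<open>
  A cardinal is a cardinal order \<open>\<tau>\<close>, i.e. \<open>Card_order \<tau>\<close>; its underlying set is \<open>Field \<tau>\<close>.
\<close>

definition C_open :: "'k rel \<Rightarrow> 'a topology \<Rightarrow> 'b topology \<Rightarrow> ('a \<Rightarrow> 'b) set \<Rightarrow> bool" where
  "C_open \<tau> X Y G \<longleftrightarrow>
     G \<subseteq> cmaps X Y \<and>
     (\<forall>h\<in>G. \<exists>F. F \<subseteq> cov Y \<and> |F| <o \<tau> \<and>
        (\<forall>g\<in>cmaps X Y. (\<forall>\<U>\<in>F. cover_close X \<U> h g) \<longrightarrow> g \<in> G))"

definition C_topology :: "'k rel \<Rightarrow> 'a topology \<Rightarrow> 'b topology \<Rightarrow> ('a \<Rightarrow> 'b) topology" where
  "C_topology \<tau> X Y = topology (C_open \<tau> X Y)"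

lemma istopology_C_open:
  assumes "Card_order \<tau>" "infinite (Field \<tau>)"
  shows "istopology (C_open \<tau> X Y)"
  unfolding istopology_def
proof (intro conjI allI impI)
  fix S T assume S: "C_open \<tau> X Y S" and T: "C_open \<tau> X Y T"
  show "C_open \<tau> X Y (S \<inter> T)"
    unfolding C_open_def
  proof (intro conjI ballI)
    show "S \<inter> T \<subseteq> cmaps X Y"
      using S by (auto simp: C_open_def)
  next
    fix h assume h: "h \<in> S \<inter> T"
    obtain F where F: "F \<subseteq> cov Y" "|F| <o \<tau>"
        "\<forall>g\<in>cmaps X Y. (\<forall>\<U>\<in>F. cover_close X \<U> h g) \<longrightarrow> g \<in> S"
      using S h unfolding C_open_def by blast
    obtain F' where F': "F' \<subseteq> cov Y" "|F'| <o \<tau>"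
        "\<forall>g\<in>cmaps X Y. (\<forall>\<U>\<in>F'. cover_close X \<U> h g) \<longrightarrow> g \<in> T"
      using T h unfolding C_open_def by blast
    have "|F \<union> F'| <o \<tau>"
      using card_of_Un_ordLess_infinite_Field[OF assms(2,1) F(2) F'(2)] .
    then show "\<exists>F. F \<subseteq> cov Y \<and> |F| <o \<tau> \<and>
        (\<forall>g\<in>cmaps X Y. (\<forall>\<U>\<in>F. cover_close X \<U> h g) \<longrightarrow> g \<in> S \<inter> T)"
      using F F' by (intro exI[of _ "F \<union> F'"]) auto
  qed
next
  fix K assume K: "\<forall>S\<in>K. C_open \<tau> X Y S"
  show "C_open \<tau> X Y (\<Union>K)"
    unfolding C_open_def
  proof (intro conjI ballI)
    show "\<Union>K \<subseteq> cmaps X Y"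
      using K by (auto simp: C_open_def)
  next
    fix h assume "h \<in> \<Union>K"
    then obtain S where S: "S \<in> K" "h \<in> S" by blast
    then have "C_open \<tau> X Y S" using K by simp
    then obtain F where "F \<subseteq> cov Y" "|F| <o \<tau>"
        "\<forall>g\<in>cmaps X Y. (\<forall>\<U>\<in>F. cover_close X \<U> h g) \<longrightarrow> g \<in> S"
      using S(2) unfolding C_open_def by blast
    then show "\<exists>F. F \<subseteq> cov Y \<and> |F| <o \<tau> \<and>
        (\<forall>g\<in>cmaps X Y. (\<forall>\<U>\<in>F. cover_close X \<U> h g) \<longrightarrow> g \<in> \<Union>K)"
      using S(1) by (intro exI[of _ F]) auto
  qed
qed

definition Z_set :: "'k rel \<Rightarrow> 'a topology \<Rightarrow> 'a set \<Rightarrow> bool" where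
  "Z_set \<tau> X A \<longleftrightarrow>
     closedin X A \<and>
     C_topology \<tau> X X closure_of {f \<in> cmaps X X. f ` topspace X \<inter> A = {}} = cmaps X X"

section \<open>The two categories\<close>

definition cube :: "'k rel \<Rightarrow> ('k \<Rightarrow> real) topology" where
  "cube \<tau> = product_topology (\<lambda>_. top_of_set {0..1}) (Field \<tau>)"

definition cat_Z :: "'k rel \<Rightarrow> (('k \<Rightarrow> real) set, ('k \<Rightarrow> real) \<Rightarrow> ('k \<Rightarrow> real)) cat" where
  "cat_Z \<tau> =
     \<lparr>cat_obj = {X. Z_set \<tau> (cube \<tau>) X},
      cat_hom = (\<lambda>X Y. cmaps (subtopology (cube \<tau>) X) (subtopology (cube \<tau>) Y)),
      cat_id = (\<lambda>X. restrict id X),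
      cat_comp = (\<lambda>X Y Z g f. compose X g f)\<rparr>"

text \<open>
  Below, \<open>U\<close> and \<open>V\<close> stand for complements of \<open>Z\<^sub>\<tau>\<close>-sets, so that the \<open>Z\<^sub>\<tau>\<close>-set
  itself is \<open>topspace (cube \<tau>) - U\<close>.
\<close>

definition proper_maps ::
  "'k rel \<Rightarrow> ('k \<Rightarrow> real) set \<Rightarrow> ('k \<Rightarrow> real) set \<Rightarrow> (('k \<Rightarrow> real) \<Rightarrow> ('k \<Rightarrow> real)) set" where
  "proper_maps \<tau> U V =
     {g \<in> cmaps (subtopology (cube \<tau>) U) (subtopology (cube \<tau>) V).
        \<forall>K. compactin (subtopology (cube \<tau>) V) K \<longrightarrow>
            compactin (subtopology (cube \<tau>) U) {x \<in> U. g x \<in> K}}"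

text \<open>
  The continuous extension of \<open>g\<close> from \<open>U\<close> to the whole cube; for proper maps between
  complements of \<open>Z\<^sub>\<tau>\<close>-sets (\<open>\<tau>\<close> uncountable) it exists uniquely, since the cube is then
  the Stone--Cech compactification of \<open>U\<close>.
\<close>

definition ext_map ::
  "'k rel \<Rightarrow> ('k \<Rightarrow> real) set \<Rightarrow> (('k \<Rightarrow> real) \<Rightarrow> ('k \<Rightarrow> real)) \<Rightarrow> ('k \<Rightarrow> real) \<Rightarrow> ('k \<Rightarrow> real)" where
  "ext_map \<tau> U g = (THE h. h \<in> cmaps (cube \<tau>) (cube \<tau>) \<and> (\<forall>x\<in>U. h x = g x))"

definition close ::
  "'k rel \<Rightarrow> ('k \<Rightarrow> real) set \<Rightarrow>
     (('k \<Rightarrow> real) \<Rightarrow> ('k \<Rightarrow> real)) \<Rightarrow> (('k \<Rightarrow> real) \<Rightarrow> ('k \<Rightarrow> real)) \<Rightarrow> bool" where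
  "close \<tau> U g1 g2 \<longleftrightarrow> (\<forall>x\<in>topspace (cube \<tau>) - U. ext_map \<tau> U g1 x = ext_map \<tau> U g2 x)"

definition close_class ::
  "'k rel \<Rightarrow> ('k \<Rightarrow> real) set \<Rightarrow> ('k \<Rightarrow> real) set \<Rightarrow>
     (('k \<Rightarrow> real) \<Rightarrow> ('k \<Rightarrow> real)) \<Rightarrow> (('k \<Rightarrow> real) \<Rightarrow> ('k \<Rightarrow> real)) set" where
  "close_class \<tau> U V g = {g' \<in> proper_maps \<tau> U V. close \<tau> U g g'}"

text \<open>
  Composition is \<open>{h} \<circ> {g} = {h \<circ> g}\<close>, written without choosing representatives as the union
  over all of them; that the union is again a single class is part of \<open>is_category\<close>.
\<close>

definition cat_Cp ::
  "'k rel \<Rightarrow> (('k \<Rightarrow> real) set, (('k \<Rightarrow> real) \<Rightarrow> ('k \<Rightarrow> real)) set) cat" where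
  "cat_Cp \<tau> =
     \<lparr>cat_obj = {topspace (cube \<tau>) - X | X. Z_set \<tau> (cube \<tau>) X},
      cat_hom = (\<lambda>U V. close_class \<tau> U V ` proper_maps \<tau> U V),
      cat_id = (\<lambda>U. close_class \<tau> U U (restrict id U)),
      cat_comp = (\<lambda>U V W n m. \<Union>h\<in>n. \<Union>g\<in>m. close_class \<tau> U W (compose U h g))\<rparr>"

section \<open>The correspondence \<open>\<lambda>\<close>\<close>

definition lambda_obj :: "'k rel \<Rightarrow> ('k \<Rightarrow> real) set \<Rightarrow> ('k \<Rightarrow> real) set" where
  "lambda_obj \<tau> U = topspace (cube \<tau>) - U"

lemma lambda_obj_complement:
  assumes "Z_set \<tau> (cube \<tau>) X"
  shows "lambda_obj \<tau> (topspace (cube \<tau>) - X) = X"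
proof -
  have "X \<subseteq> topspace (cube \<tau>)"
    using assms by (simp add: Z_set_def closedin_subset)
  then show ?thesis by (simp add: lambda_obj_def double_diff)
qed

text \<open>
  The restriction to the \<open>Z\<^sub>\<tau>\<close>-set of the extension of \<open>g\<close> is the same for all \<open>g\<close> in a
  closeness class \<open>m\<close>, so the set below is a singleton.
\<close>

definition lambda_mor ::
  "'k rel \<Rightarrow> ('k \<Rightarrow> real) set \<Rightarrow> ('k \<Rightarrow> real) set \<Rightarrow>
     (('k \<Rightarrow> real) \<Rightarrow> ('k \<Rightarrow> real)) set \<Rightarrow> ('k \<Rightarrow> real) \<Rightarrow> ('k \<Rightarrow> real)" where
  "lambda_mor \<tau> U V m =
     the_elem ((\<lambda>g. restrict (ext_map \<tau> U g) (topspace (cube \<tau>) - U)) ` m)"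

lemma lambda_mor_close_class:
  assumes "g \<in> proper_maps \<tau> U V"
  shows "lambda_mor \<tau> U V (close_class \<tau> U V g) =
    restrict (ext_map \<tau> U g) (topspace (cube \<tau>) - U)"
proof -
  let ?r = "\<lambda>g. restrict (ext_map \<tau> U g) (topspace (cube \<tau>) - U)"
  have "g \<in> close_class \<tau> U V g"
    using assms by (simp add: close_class_def close_def)
  moreover have "?r g' = ?r g" if "g' \<in> close_class \<tau> U V g" for g'
  proof (rule restrict_ext)
    fix x assume "x \<in> topspace (cube \<tau>) - U"
    then show "ext_map \<tau> U g' x = ext_map \<tau> U g x"
      using that unfolding close_class_def close_def by simp
  qed
  ultimately have "?r ` close_class \<tau> U V g = {?r g}"
    by blast
  then show ?thesis by (simp add: lambda_mor_def)
qed

end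

theory Submission
  imports Defs
begin

text \<open>
  Let \<open>D\<close> be the cube over an uncountable cardinal \<open>\<tau>\<close>, \<open>X\<close> and \<open>Y\<close> two \<open>Z\<^sub>\<tau>\<close>-sets in it and
  \<open>U\<close>, \<open>V\<close> their complements.  Everything rests on one consequence of the \<open>Z\<^sub>\<tau>\<close>-property
  (\<open>Z_set_complement_pushable\<close>): for every set \<open>B\<close> of fewer than \<open>\<tau>\<close> coordinates there is a map
  \<open>r : D \<rightarrow> U\<close> that leaves the coordinates in \<open>B\<close> unchanged.  Indeed, fewer than \<open>\<tau>\<close> countable
  covers suffice to force equality of all coordinates in \<open>B\<close>, so the identity is a limit of
  maps into \<open>U\<close> only if such an \<open>r\<close> exists.

  From this one gets that every map from \<open>U\<close> to a cube extends to \<open>D\<close>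
  (\<open>extend_continuous_cube\<close>).  A real function \<open>\<phi>\<close> on the open set \<open>U\<close> depends on countably many
  coordinates, because the closure of an open set of the cube does
  (\<open>closure_of_open_countably_determined\<close>); if \<open>r\<close> fixes these coordinates, then \<open>\<phi> \<circ> r\<close> is the
  extension.  Since \<open>U\<close> is dense, the extension is unique, and by compactness the
  extension of a proper map \<open>U \<rightarrow> V\<close> takes \<open>X\<close> into \<open>Y\<close>.  So proper maps \<open>U \<rightarrow> V\<close> are the same
  as maps \<open>h : D \<rightarrow> D\<close> with \<open>h\<close> taking \<open>U\<close> into \<open>V\<close> and \<open>X\<close> into \<open>Y\<close>, two of them are close iff
  their extensions agree on \<open>X\<close>, and extensions are compatible with composition.  Hence the
  correspondence is functorial and faithful, and it is bijective on objects by definition.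

  It is full because every map \<open>f : X \<rightarrow> Y\<close> is the restriction of a map \<open>h\<close> as above
  (\<open>extend_off_Z_set\<close>).  The Tietze theorem gives some \<open>F : D \<rightarrow> D\<close> that extends \<open>f\<close>, and \<open>F\<close> has to be
  moved off \<open>Y\<close> at all points outside \<open>X\<close>.  The set \<open>U\<close> is covered by \<open>\<tau>\<close> sets \<open>{t\<^sub>a = 1}\<close>, where each
  \<open>t\<^sub>a\<close> is a function into the unit interval that vanishes on \<open>X\<close>.  Compactness improves the map \<open>r\<close>
  for \<open>Y\<close>: it may be taken to change only finitely many coordinates, and finitely many
  coordinates of \<open>r x\<close> suffice to certify that it lies in \<open>V\<close>.  A transfinite recursion of length
  \<open>\<tau>\<close> (\<open>push_along_functions\<close>) now pushes \<open>F\<close> along each \<open>t\<^sub>a\<close> in turn, at each stage changing only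
  coordinates on which no earlier certificate depends.  This is possible since fewer than
  \<open>\<tau>\<close> coordinates are in use before any stage, and no later stage undoes what an earlier one achieved.
\<close>

section \<open>Cardinal arithmetic\<close>

lemma infinite_Field:
  assumes "Card_order \<tau>" "natLeq <o \<tau>"
  shows "infinite (Field \<tau>)"
proof -
  have "|UNIV :: nat set| \<le>o |Field \<tau>|"
    using assms card_of_nat card_of_Field_ordIso
    by (meson ordIso_ordLess_trans ordIso_symmetric ordLess_imp_ordLeq ordLess_ordIso_trans)
  then show ?thesis by (simp add: infinite_iff_card_of_nat)
qed

lemma countable_UN_ordLess:
  assumes \<tau>: "Card_order \<tau>" "natLeq <o \<tau>"
    and A: "|A| <o \<tau>" and f: "\<And>a. a \<in> A \<Longrightarrow> countable (f a)"
  shows "|\<Union>a\<in>A. f a| <o \<tau>"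
proof -
  have nat: "|UNIV :: nat set| <o \<tau>"
    using \<tau>(2) card_of_nat ordIso_ordLess_trans by blast
  have "|A \<times> (UNIV :: nat set)| <o \<tau>"
  proof (cases "finite A")
    case True
    then have "countable (A \<times> (UNIV :: nat set))"
      by (simp add: countable_finite)
    then have "|A \<times> (UNIV :: nat set)| \<le>o |UNIV :: nat set|"
      by (metis countableE card_of_ordLeq top_greatest)
    with nat show ?thesis using ordLeq_ordLess_trans by blast
  next
    case False
    then have "|UNIV :: nat set| \<le>o |A|" by (simp add: infinite_iff_card_of_nat)
    then have "|A \<times> (UNIV :: nat set)| =o |A|"
      using False by (intro card_of_Times_infinite_simps) auto
    with A show ?thesis using ordIso_ordLess_trans by blast
  qed
  moreover have "(\<Union>a\<in>A. f a) \<subseteq> (\<lambda>(a, n). from_nat_into (f a) n) ` (A \<times> UNIV)"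
  proof
    fix y assume "y \<in> (\<Union>a\<in>A. f a)"
    then obtain a where a: "a \<in> A" "y \<in> f a" by blast
    then obtain n where "y = from_nat_into (f a) n"
      using f[OF a(1)] by (metis from_nat_into_surj)
    with a show "y \<in> (\<lambda>(a, n). from_nat_into (f a) n) ` (A \<times> UNIV)" by force
  qed
  ultimately show ?thesis
    by (meson card_of_image card_of_mono1 ordLeq_ordLess_trans)
qed

lemma countable_ordLess:
  assumes "natLeq <o \<tau>" "countable A"
  shows "|A| <o \<tau>"
proof -
  have "|A| \<le>o |UNIV :: nat set|"
    using assms(2) by (metis countableE card_of_ordLeq top_greatest)
  then show ?thesis
    using assms(1) card_of_nat ordIso_ordLess_trans ordLeq_ordLess_trans by blast
qed

lemma card_of_lists_ordLeq:
  assumes "infinite A"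
  shows "|lists A| \<le>o |A|"
proof -
  have step: "|{xs \<in> lists A. length xs = n}| \<le>o |A|" for n
  proof (induction n)
    case 0
    have "{xs \<in> lists A. length xs = 0} = {[]}" by auto
    then show ?case
      using assms by (metis card_of_ordLeq_infinite finite.emptyI finite_insert ordLeq_total card_of_Well_order)
  next
    case (Suc n)
    let ?L = "{xs \<in> lists A. length xs = n}"
    have "{xs \<in> lists A. length xs = Suc n} \<subseteq> (\<lambda>(x, xs). x # xs) ` (A \<times> ?L)"
    proof
      fix ys assume "ys \<in> {xs \<in> lists A. length xs = Suc n}"
      then obtain x xs where "ys = x # xs" "x \<in> A" "xs \<in> ?L"
        by (cases ys) auto
      then show "ys \<in> (\<lambda>(x, xs). x # xs) ` (A \<times> ?L)" by force
    qed
    then have "|{xs \<in> lists A. length xs = Suc n}| \<le>o |A \<times> ?L|"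
      by (meson card_of_image card_of_mono1 ordLeq_transitive)
    also have "|A \<times> ?L| \<le>o |A|"
      using assms Suc.IH
      by (intro card_of_Sigma_ordLeq_infinite) (auto simp: card_of_mono1)
    finally show ?case .
  qed
  have "lists A = (\<Union>n. {xs \<in> lists A. length xs = n})" by auto
  moreover have "|\<Union>n. {xs \<in> lists A. length xs = n}| \<le>o |A|"
    using assms step by (intro card_of_UNION_ordLeq_infinite) (auto simp: infinite_iff_card_of_nat)
  ultimately show ?thesis by simp
qed

section \<open>Rational boxes in the cube\<close>

lemma topspace_cube: "topspace (cube \<tau>) = (\<Pi>\<^sub>E k\<in>Field \<tau>. {0..1})"
  by (simp add: cube_def)

lemma compact_space_cube: "compact_space (cube \<tau>)"
  unfolding cube_def
  by (simp add: compact_space_product_topology compact_space_subtopology)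

lemma Hausdorff_space_cube: "Hausdorff_space (cube \<tau>)"
  unfolding cube_def
  by (simp add: Hausdorff_space_product_topology Hausdorff_space_subtopology)

lemma normal_space_cube: "normal_space (cube \<tau>)"
  by (simp add: compact_Hausdorff_or_regular_imp_normal_space compact_space_cube Hausdorff_space_cube)

lemma regular_space_cube: "regular_space (cube \<tau>)"
  by (simp add: compact_Hausdorff_imp_regular_space compact_space_cube Hausdorff_space_cube)

lemma continuous_map_cube_coord:
  assumes "k \<in> Field \<tau>"
  shows "continuous_map (cube \<tau>) euclideanreal (\<lambda>x. x k)"
  unfolding cube_def
  using continuous_map_product_projection[OF assms, of "\<lambda>_. top_of_set {0..1::real}"]
  by (rule continuous_map_into_fulltopology)

lemma continuous_map_into_cube:
  "continuous_map Q (cube \<tau>) f \<longleftrightarrow>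
     f ` topspace Q \<subseteq> topspace (cube \<tau>) \<and>
     (\<forall>k\<in>Field \<tau>. continuous_map Q euclideanreal (\<lambda>x. f x k))"
  unfolding cube_def
  by (auto simp: continuous_map_componentwise continuous_map_in_subtopology PiE_iff
      Pi_iff image_subset_iff)

text \<open>
  Boxes are coded by lists with rational bounds so that they can be counted: there are
  countably many over a countable set of coordinates, and no more than \<open>\<tau>\<close> altogether.
\<close>

definition rat_box :: "'k rel \<Rightarrow> ('k \<times> rat \<times> rat) list \<Rightarrow> ('k \<Rightarrow> real) set" where
  "rat_box \<tau> ps = {x \<in> topspace (cube \<tau>). \<forall>(k, q, r)\<in>set ps. of_rat q < x k \<and> x k < of_rat r}"

lemma openin_rat_box:
  assumes "ps \<in> lists (Field \<tau> \<times> UNIV)"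
  shows "openin (cube \<tau>) (rat_box \<tau> ps)"
  using assms
proof (induction ps)
  case Nil
  then show ?case by (simp add: rat_box_def)
next
  case (Cons p ps)
  obtain k q r where p: "p = (k, q, r)" by (cases p)
  with Cons have k: "k \<in> Field \<tau>" by auto
  have "openin (cube \<tau>) {x \<in> topspace (cube \<tau>). x k \<in> {of_rat q<..<of_rat r}}"
    by (rule openin_continuous_map_preimage[OF continuous_map_cube_coord[OF k]]) auto
  moreover have "rat_box \<tau> (p # ps) =
      {x \<in> topspace (cube \<tau>). x k \<in> {of_rat q<..<of_rat r}} \<inter> rat_box \<tau> ps"
    by (auto simp: rat_box_def p)
  ultimately show ?case using Cons by (auto intro: openin_Int)
qed

lemma rat_box_basis:
  assumes S: "openin (cube \<tau>) S" and x: "x \<in> S"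
  obtains ps where "ps \<in> lists (Field \<tau> \<times> UNIV)" "x \<in> rat_box \<tau> ps" "rat_box \<tau> ps \<subseteq> S"
proof -
  obtain U where fin: "finite {i \<in> Field \<tau>. U i \<noteq> {0..1}}"
    and U: "\<And>i. i \<in> Field \<tau> \<Longrightarrow> openin (top_of_set {0..1::real}) (U i)"
    and xU: "x \<in> Pi\<^sub>E (Field \<tau>) U" and US: "Pi\<^sub>E (Field \<tau>) U \<subseteq> S"
    using S x unfolding cube_def openin_product_topology_alt by auto
  have "\<exists>q r. of_rat q < x i \<and> x i < of_rat r \<and>
      (\<forall>y\<in>{0..1}. of_rat q < y \<and> y < of_rat r \<longrightarrow> y \<in> U i)" if i: "i \<in> Field \<tau>" for i
  proof -
    obtain W where W: "open W" "U i = {0..1} \<inter> W"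
      using U[OF i] unfolding openin_open by blast
    have "x i \<in> W" using xU i W(2) by (auto simp: PiE_iff)
    then obtain e where e: "e > 0" "\<And>y. \<bar>y - x i\<bar> < e \<Longrightarrow> y \<in> W"
      using W(1) unfolding open_real by blast
    obtain q where q: "x i - e < of_rat q" "of_rat q < x i"
      using of_rat_dense[of "x i - e" "x i"] e(1) by auto
    obtain r where r: "x i < of_rat r" "of_rat r < x i + e"
      using of_rat_dense[of "x i" "x i + e"] e(1) by auto
    have "y \<in> U i" if "y \<in> {0..1}" "of_rat q < y" "y < of_rat r" for y
    proof -
      have "\<bar>y - x i\<bar> < e" using q r that by linarith
      then show ?thesis using e(2) W(2) that(1) by blast
    qed
    then show ?thesis using q r by blast
  qed
  then obtain q r where qr: "\<And>i. i \<in> Field \<tau> \<Longrightarrow> of_rat (q i) < x i \<and> x i < of_rat (r i) \<and>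
      (\<forall>y\<in>{0..1}. of_rat (q i) < y \<and> y < of_rat (r i) \<longrightarrow> y \<in> U i)"
    by metis
  obtain js where js: "set js = {i \<in> Field \<tau>. U i \<noteq> {0..1}}"
    using fin finite_list by blast
  define ps where "ps = map (\<lambda>i. (i, q i, r i)) js"
  have ps: "set ps = (\<lambda>i. (i, q i, r i)) ` {i \<in> Field \<tau>. U i \<noteq> {0..1}}"
    by (simp add: ps_def js)
  show ?thesis
  proof
    show "ps \<in> lists (Field \<tau> \<times> UNIV)"
      using ps by (auto simp: in_lists_conv_set)
    show "x \<in> rat_box \<tau> ps"
      using qr S x openin_subset by (fastforce simp: rat_box_def ps)
    show "rat_box \<tau> ps \<subseteq> S"
    proof
      fix y assume y: "y \<in> rat_box \<tau> ps"
      then have y01: "y \<in> (\<Pi>\<^sub>E k\<in>Field \<tau>. {0..1})" by (simp add: rat_box_def topspace_cube)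
      have "y i \<in> U i" if i: "i \<in> Field \<tau>" for i
      proof (cases "U i = {0..1}")
        case True
        then show ?thesis using y01 i by (auto simp: PiE_iff)
      next
        case False
        then have "of_rat (q i) < y i \<and> y i < of_rat (r i)"
          using y i by (auto simp: rat_box_def ps)
        then show ?thesis using qr[OF i] y01 i by (auto simp: PiE_iff)
      qed
      then have "y \<in> Pi\<^sub>E (Field \<tau>) U" using y01 by (auto simp: PiE_iff)
      then show "y \<in> S" using US by blast
    qed
  qed
qed

lemma rat_box_cong:
  assumes "x \<in> rat_box \<tau> ps" "y \<in> topspace (cube \<tau>)" "\<And>k. k \<in> fst ` set ps \<Longrightarrow> y k = x k"
  shows "y \<in> rat_box \<tau> ps"
  using assms by (force simp: rat_box_def)

lemma restrict_cmap_id: "continuous_map X X (restrict id (topspace X))"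
  by (rule continuous_map_eq[OF continuous_map_id]) simp

lemma closure_of_meets:
  assumes "x \<in> X closure_of S" "openin X T" "x \<in> T"
  obtains y where "y \<in> S" "y \<in> T"
  using assms by (auto simp: in_closure_of)

section \<open>Pushing the cube off a \<open>Z\<^sub>\<tau>\<close>-set\<close>

text \<open>
  This is the form in which the \<open>Z\<^sub>\<tau>\<close>-property of the complement of \<open>V\<close> is used throughout.
\<close>

definition pushable :: "'k rel \<Rightarrow> ('k \<Rightarrow> real) set \<Rightarrow> bool" where
  "pushable \<tau> V \<longleftrightarrow>
     (\<forall>B. B \<subseteq> Field \<tau> \<and> |B| <o \<tau> \<longrightarrow>
        (\<exists>r. continuous_map (cube \<tau>) (cube \<tau>) r \<and> r ` topspace (cube \<tau>) \<subseteq> V \<and>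
             (\<forall>x\<in>topspace (cube \<tau>). \<forall>k\<in>B. r x k = x k)))"

lemma pushableE:
  assumes "pushable \<tau> V" "B \<subseteq> Field \<tau>" "|B| <o \<tau>"
  obtains r where "continuous_map (cube \<tau>) (cube \<tau>) r" "r ` topspace (cube \<tau>) \<subseteq> V"
    "\<And>x k. \<lbrakk>x \<in> topspace (cube \<tau>); k \<in> B\<rbrakk> \<Longrightarrow> r x k = x k"
proof -
  have "\<exists>r. continuous_map (cube \<tau>) (cube \<tau>) r \<and> r ` topspace (cube \<tau>) \<subseteq> V \<and>
      (\<forall>x\<in>topspace (cube \<tau>). \<forall>k\<in>B. r x k = x k)"
    using assms(2,3) assms(1)[unfolded pushable_def, rule_format, of B] by simp
  then show thesis using that by (elim exE conjE) simp
qed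

text \<open>Maps that agree with the identity on the coordinates in \<open>B\<close> form a neighbourhood of the
  identity in \<open>C\<^sub>\<tau>(D, D)\<close>: covering the cube by strips of width \<open>2 / (n + 1)\<close> over a coordinate, for
  all \<open>n\<close>, takes countably many covers per coordinate, hence fewer than \<open>\<tau>\<close> in total.\<close>

lemma Z_set_complement_pushable:
  assumes \<tau>: "Card_order \<tau>" "natLeq <o \<tau>" and A: "Z_set \<tau> (cube \<tau>) A"
  shows "pushable \<tau> (topspace (cube \<tau>) - A)"
  unfolding pushable_def
proof (intro allI impI, elim conjE)
  fix B assume B: "B \<subseteq> Field \<tau>" and card_B: "|B| <o \<tau>"
  let ?D = "cube \<tau>"
  define strip where "strip k n q = {x \<in> topspace ?D. \<bar>x k - of_rat q\<bar> < 1 / real (Suc n)}"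
    for k n and q :: rat
  define \<C> where "\<C> k n = range (strip k n)" for k n
  have cov: "\<C> k n \<in> cov ?D" if "k \<in> B" for k n
  proof -
    have "functionally_open ?D (strip k n q)" for q
      unfolding functionally_open_def
    proof (intro exI conjI)
      let ?\<phi> = "\<lambda>x :: 'a \<Rightarrow> real. max 0 (1 / real (Suc n) - \<bar>x k - of_rat q\<bar>)"
      have "k \<in> Field \<tau>" using B that by blast
      then show "continuous_map ?D euclideanreal ?\<phi>"
        by (intro continuous_intros continuous_map_cube_coord)
      show "strip k n q = {x \<in> topspace ?D. ?\<phi> x \<noteq> 0}"
        by (auto simp: strip_def max_def)
    qed
    moreover have "\<exists>q. x \<in> strip k n q" if "x \<in> topspace ?D" for x
    proof -
      obtain q where "x k - 1 / real (Suc n) < of_rat q" "of_rat q < x k"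
        using of_rat_dense[of "x k - 1 / real (Suc n)" "x k"] by auto
      then show ?thesis using that by (auto simp: strip_def intro!: exI[of _ q])
    qed
    moreover have "strip k n q \<subseteq> topspace ?D" for q by (auto simp: strip_def)
    ultimately have "\<Union>(\<C> k n) = topspace ?D" "\<forall>U\<in>\<C> k n. functionally_open ?D U"
      by (auto simp: \<C>_def)
    then show ?thesis by (simp add: cov_def \<C>_def)
  qed
  define F where "F = (\<Union>k\<in>B. range (\<C> k))"
  have F: "F \<subseteq> cov ?D" "|F| <o \<tau>"
    using cov countable_UN_ordLess[OF \<tau> card_B, of "\<lambda>k. range (\<C> k)"] by (auto simp: F_def)
  have strip_eq: "g x k = h x k"
    if close: "\<forall>\<U>\<in>F. cover_close ?D \<U> h g" and x: "x \<in> topspace ?D" and k: "k \<in> B"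
    for g h :: "('a \<Rightarrow> real) \<Rightarrow> 'a \<Rightarrow> real" and x k
  proof (rule ccontr)
    assume "g x k \<noteq> h x k"
    then obtain n where n: "inverse (real (Suc n)) < \<bar>g x k - h x k\<bar> / 2"
      using reals_Archimedean[of "\<bar>g x k - h x k\<bar> / 2"] by auto
    have "cover_close ?D (\<C> k n) h g" using close k by (auto simp: F_def)
    then obtain q where "h x \<in> strip k n q" "g x \<in> strip k n q"
      using x by (auto simp: cover_close_def \<C>_def)
    then show False using n by (auto simp: strip_def inverse_eq_divide)
  qed
  define G where "G = {g \<in> cmaps ?D ?D. \<forall>x\<in>topspace ?D. \<forall>k\<in>B. g x k = x k}"
  have "C_open \<tau> ?D ?D G"
    unfolding C_open_def
  proof (intro conjI ballI)
    show "G \<subseteq> cmaps ?D ?D" by (auto simp: G_def)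
    fix h assume "h \<in> G"
    then have "\<forall>g\<in>cmaps ?D ?D. (\<forall>\<U>\<in>F. cover_close ?D \<U> h g) \<longrightarrow> g \<in> G"
      using strip_eq[of h] by (auto simp: G_def)
    then show "\<exists>F. F \<subseteq> cov ?D \<and> |F| <o \<tau> \<and>
        (\<forall>g\<in>cmaps ?D ?D. (\<forall>\<U>\<in>F. cover_close ?D \<U> h g) \<longrightarrow> g \<in> G)"
      using F by blast
  qed
  then have "openin (C_topology \<tau> ?D ?D) G"
    unfolding C_topology_def
    by (simp add: topology_inverse' istopology_C_open \<tau> infinite_Field)
  moreover have id: "restrict id (topspace ?D) \<in> cmaps ?D ?D"
    by (simp add: cmaps_def restrict_cmap_id)
  then have "restrict id (topspace ?D) \<in> G" by (simp add: G_def)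
  moreover have "restrict id (topspace ?D) \<in> C_topology \<tau> ?D ?D closure_of
      {f \<in> cmaps ?D ?D. f ` topspace ?D \<inter> A = {}}"
    using A id by (simp add: Z_set_def)
  ultimately obtain r where r: "r \<in> G" "r \<in> cmaps ?D ?D" "r ` topspace ?D \<inter> A = {}"
    unfolding in_closure_of by blast
  moreover have "r ` topspace ?D \<subseteq> topspace ?D"
    using r(2) by (simp add: cmaps_def continuous_map_image_subset_topspace)
  ultimately show "\<exists>r. continuous_map ?D ?D r \<and> r ` topspace ?D \<subseteq> topspace ?D - A \<and>
      (\<forall>x\<in>topspace ?D. \<forall>k\<in>B. r x k = x k)"
    by (intro exI[of _ r]) (auto simp: G_def cmaps_def)
qed

text \<open>A basic box restricts finitely many coordinates only, so a push that keeps these moves any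
  point of the box into \<open>V\<close> inside the box.\<close>

lemma pushable_dense:
  assumes "natLeq <o \<tau>" "pushable \<tau> V" "V \<subseteq> topspace (cube \<tau>)"
  shows "cube \<tau> closure_of V = topspace (cube \<tau>)"
proof -
  have "x \<in> cube \<tau> closure_of V" if x: "x \<in> topspace (cube \<tau>)" for x
    unfolding in_closure_of
  proof (intro conjI allI impI x)
    fix T assume "x \<in> T \<and> openin (cube \<tau>) T"
    then obtain ps where ps: "ps \<in> lists (Field \<tau> \<times> UNIV)" "x \<in> rat_box \<tau> ps" "rat_box \<tau> ps \<subseteq> T"
      using rat_box_basis by metis
    have "fst ` set ps \<subseteq> Field \<tau>" "|fst ` set ps| <o \<tau>"
      using ps(1) assms(1) by (auto simp: in_lists_conv_set intro!: countable_ordLess countable_finite)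
    with assms(2) obtain r where r: "r ` topspace (cube \<tau>) \<subseteq> V"
        "\<And>x k. \<lbrakk>x \<in> topspace (cube \<tau>); k \<in> fst ` set ps\<rbrakk> \<Longrightarrow> r x k = x k"
      by (rule pushableE) simp
    have "r x \<in> rat_box \<tau> ps"
      by (rule rat_box_cong[OF ps(2)]) (use r x assms(3) in auto)
    then show "\<exists>y. y \<in> V \<and> y \<in> T" using r(1) x ps(3) by blast
  qed
  then show ?thesis by (intro subset_antisym closure_of_subset_topspace subsetI)
qed

section \<open>Extending maps over a \<open>Z\<^sub>\<tau>\<close>-set\<close>

text \<open>The set \<open>B\<close> is built by closing off: whenever a box over \<open>B\<close> meets \<open>P\<close>, a smaller box inside \<open>P\<close> also
  has its coordinates in \<open>B\<close>.  If \<open>x\<close> is in the closure of \<open>P\<close> and \<open>y\<close> agrees with \<open>x\<close> on \<open>B\<close>, then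
  for any box around \<open>y\<close> the conditions on coordinates in \<open>B\<close> can be met inside \<open>P\<close> by a box over \<open>B\<close>,
  and the remaining conditions concern coordinates that this box leaves free.\<close>

lemma closure_of_open_countably_determined:
  assumes P: "openin (cube \<tau>) P"
  obtains B where "B \<subseteq> Field \<tau>" "countable B"
    "\<And>x y. \<lbrakk>x \<in> cube \<tau> closure_of P; y \<in> topspace (cube \<tau>); \<forall>k\<in>B. y k = x k\<rbrakk>
       \<Longrightarrow> y \<in> cube \<tau> closure_of P"
proof -
  let ?L = "lists (Field \<tau> \<times> (UNIV :: (rat \<times> rat) set))"
  have "\<exists>qs\<in>?L. rat_box \<tau> ps \<inter> P \<noteq> {} \<longrightarrow> rat_box \<tau> qs \<noteq> {} \<and> rat_box \<tau> qs \<subseteq> rat_box \<tau> ps \<inter> P"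
    if "ps \<in> ?L" for ps
  proof (cases "rat_box \<tau> ps \<inter> P = {}")
    case True
    then show ?thesis by (intro bexI[of _ "[]"]) auto
  next
    case False
    then obtain z where z: "z \<in> rat_box \<tau> ps \<inter> P" by blast
    have "openin (cube \<tau>) (rat_box \<tau> ps \<inter> P)" using openin_rat_box[OF that] P by blast
    from this z obtain qs where "qs \<in> ?L" "z \<in> rat_box \<tau> qs" "rat_box \<tau> qs \<subseteq> rat_box \<tau> ps \<inter> P"
      by (rule rat_box_basis)
    then show ?thesis by (intro bexI[of _ qs]) auto
  qed
  then obtain E where E_both: "\<And>ps. ps \<in> ?L \<Longrightarrow> E ps \<in> ?L \<and>
      (rat_box \<tau> ps \<inter> P \<noteq> {} \<longrightarrow> rat_box \<tau> (E ps) \<noteq> {} \<and> rat_box \<tau> (E ps) \<subseteq> rat_box \<tau> ps \<inter> P)"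
    unfolding Bex_def by (metis (no_types, lifting))
  then have E: "\<And>ps. ps \<in> ?L \<Longrightarrow> E ps \<in> ?L"
    and E': "\<And>ps. \<lbrakk>ps \<in> ?L; rat_box \<tau> ps \<inter> P \<noteq> {}\<rbrakk> \<Longrightarrow>
       rat_box \<tau> (E ps) \<noteq> {} \<and> rat_box \<tau> (E ps) \<subseteq> rat_box \<tau> ps \<inter> P"
    by auto
  define next_B where "next_B B = B \<union> (\<Union>ps\<in>lists (B \<times> UNIV). fst ` set (E ps))" for B
  define Bn where "Bn n = (next_B ^^ n) {}" for n
  have Bn_Suc: "Bn (Suc n) = next_B (Bn n)" for n by (simp add: Bn_def)
  have Bn: "Bn n \<subseteq> Field \<tau> \<and> countable (Bn n)" for n
  proof (induction n)
    case 0
    then show ?case by (simp add: Bn_def)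
  next
    case (Suc n)
    have "fst ` set (E ps) \<subseteq> Field \<tau>" if "ps \<in> lists (Bn n \<times> UNIV)" for ps
    proof -
      have "ps \<in> ?L" using that Suc.IH by (auto simp: in_lists_conv_set)
      then show ?thesis using E by (force simp: in_lists_conv_set)
    qed
    moreover have "countable (\<Union>ps\<in>lists (Bn n \<times> UNIV). fst ` set (E ps))"
      using Suc.IH by (intro countable_UN) (auto intro: countable_finite)
    ultimately show ?case
      using Suc.IH unfolding Bn_Suc next_B_def by auto
  qed
  have mono: "Bn m \<subseteq> Bn n" if "m \<le> n" for m n
    using that by (rule lift_Suc_mono_le[of Bn, rotated]) (auto simp: Bn_Suc next_B_def)
  define B where "B = (\<Union>n. Bn n)"
  show ?thesis
  proof
    show "B \<subseteq> Field \<tau>" "countable B" using Bn by (auto simp: B_def)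
    fix x y assume x: "x \<in> cube \<tau> closure_of P" and y: "y \<in> topspace (cube \<tau>)"
      and xy: "\<forall>k\<in>B. y k = x k"
    show "y \<in> cube \<tau> closure_of P"
      unfolding in_closure_of
    proof (intro conjI allI impI y)
      fix T assume "y \<in> T \<and> openin (cube \<tau>) T"
      then obtain ps where ps: "ps \<in> ?L" "y \<in> rat_box \<tau> ps" "rat_box \<tau> ps \<subseteq> T"
        using rat_box_basis by metis
      \<comment> \<open>The part of the box around \<open>y\<close> that \<open>x\<close> satisfies as well.\<close>
      define qs where "qs = filter (\<lambda>p. fst p \<in> B) ps"
      have qs: "qs \<in> ?L" using ps(1) by (auto simp: qs_def)
      have "\<exists>n. K \<subseteq> Bn n" if "finite K" "K \<subseteq> B" for K
        using that
      proof induction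
        case (insert k K)
        then obtain m n where "K \<subseteq> Bn m" "k \<in> Bn n" by (auto simp: B_def)
        then have "insert k K \<subseteq> Bn (max m n)" using mono[of m "max m n"] mono[of n "max m n"] by auto
        then show ?case by blast
      qed auto
      from this[of "fst ` set qs"] obtain n where "fst ` set qs \<subseteq> Bn n" by (auto simp: qs_def)
      then have "qs \<in> lists (Bn n \<times> UNIV)"
        by (force simp: in_lists_conv_set)
      then have "fst ` set (E qs) \<subseteq> Bn (Suc n)"
        by (auto simp: Bn_Suc next_B_def)
      then have EB: "fst ` set (E qs) \<subseteq> B" by (auto simp: B_def)
      have "y \<in> rat_box \<tau> qs" using ps(2) by (auto simp: rat_box_def qs_def)
      moreover have "x \<in> topspace (cube \<tau>)" using x by (simp add: in_closure_of)
      ultimately have "x \<in> rat_box \<tau> qs"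
        by (rule rat_box_cong) (auto simp: qs_def xy)
      then have "rat_box \<tau> qs \<inter> P \<noteq> {}"
        using x openin_rat_box[OF qs] unfolding in_closure_of by blast
      then obtain z where z: "z \<in> rat_box \<tau> (E qs)" and Eqs: "rat_box \<tau> (E qs) \<subseteq> rat_box \<tau> qs \<inter> P"
        using E'[OF qs] by blast
      \<comment> \<open>This point lies in \<open>P\<close> because \<open>z\<close> does, and it satisfies all conditions of the box around \<open>y\<close>.\<close>
      define w where "w k = (if k \<in> B then z k else y k)" for k
      have w: "w \<in> topspace (cube \<tau>)"
        using y z \<open>B \<subseteq> Field \<tau>\<close>
        by (auto simp: w_def rat_box_def topspace_cube PiE_iff extensional_def)
      have wE: "w \<in> rat_box \<tau> (E qs)"
        using z w by (rule rat_box_cong) (use EB in \<open>auto simp: w_def\<close>)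
      then have "w \<in> rat_box \<tau> qs" using Eqs by blast
      then have "w \<in> rat_box \<tau> ps"
        using ps(2) w by (fastforce simp: rat_box_def qs_def w_def)
      then show "\<exists>z. z \<in> P \<and> z \<in> T" using wE Eqs ps(3) by blast
    qed
  qed
qed

text \<open>Two points with \<open>\<phi> u < q < \<phi> v\<close> are separated by the closure of \<open>{\<phi> < q}\<close>, and for all rational \<open>q\<close>
  together these closures are determined by countably many coordinates.\<close>

lemma continuous_real_countably_determined:
  assumes U: "openin (cube \<tau>) U"
    and \<phi>: "continuous_map (subtopology (cube \<tau>) U) euclideanreal \<phi>"
  obtains B where "B \<subseteq> Field \<tau>" "countable B"
    "\<And>u v. \<lbrakk>u \<in> U; v \<in> U; \<And>k. k \<in> B \<Longrightarrow> v k = u k\<rbrakk> \<Longrightarrow> \<phi> v = \<phi> u"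
proof -
  have open_pre: "openin (cube \<tau>) {u \<in> U. \<phi> u \<in> T}" if "open T" for T
  proof -
    have "topspace (subtopology (cube \<tau>) U) = U"
      using openin_subset[OF U] by auto
    moreover have "openin (subtopology (cube \<tau>) U) {u \<in> topspace (subtopology (cube \<tau>) U). \<phi> u \<in> T}"
      using that by (intro openin_continuous_map_preimage[OF \<phi>]) auto
    ultimately show ?thesis using openin_trans_full[OF _ U] by metis
  qed
  define P where "P q = {u \<in> U. \<phi> u \<in> {..<of_rat q}}" for q :: rat
  have "\<exists>B. B \<subseteq> Field \<tau> \<and> countable B \<and>
    (\<forall>x y. x \<in> cube \<tau> closure_of P q \<and> y \<in> topspace (cube \<tau>) \<and> (\<forall>k\<in>B. y k = x k)
       \<longrightarrow> y \<in> cube \<tau> closure_of P q)" for q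
  proof -
    have "openin (cube \<tau>) (P q)" unfolding P_def by (rule open_pre) simp
    then obtain B where B: "B \<subseteq> Field \<tau>" "countable B"
      "\<And>x y. \<lbrakk>x \<in> cube \<tau> closure_of P q; y \<in> topspace (cube \<tau>); \<forall>k\<in>B. y k = x k\<rbrakk>
         \<Longrightarrow> y \<in> cube \<tau> closure_of P q"
      by (rule closure_of_open_countably_determined) simp
    show ?thesis
      by (intro exI[of _ B] conjI allI impI B(1,2); elim conjE; rule B(3); assumption)
  qed
  then obtain Bq where Bq: "\<And>q. Bq q \<subseteq> Field \<tau>" "\<And>q. countable (Bq q)"
    and det: "\<And>q x y. \<lbrakk>x \<in> cube \<tau> closure_of P q; y \<in> topspace (cube \<tau>); \<forall>k\<in>Bq q. y k = x k\<rbrakk>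
       \<Longrightarrow> y \<in> cube \<tau> closure_of P q"
    by metis
  let ?B = "\<Union>q. Bq q"
  have not_less: "\<not> \<phi> u < \<phi> v" if uv: "u \<in> U" "v \<in> U" "\<And>k. k \<in> ?B \<Longrightarrow> v k = u k" for u v
  proof
    assume "\<phi> u < \<phi> v"
    then obtain q where q: "\<phi> u < of_rat q" "of_rat q < \<phi> v" using of_rat_dense by blast
    have "u \<in> cube \<tau> closure_of P q"
      using q(1) uv(1) openin_subset[OF U] closure_of_subset[of "P q" "cube \<tau>"]
      by (auto simp: P_def)
    then have "v \<in> cube \<tau> closure_of P q"
      using det uv openin_subset[OF U] by blast
    moreover have "openin (cube \<tau>) {w \<in> U. \<phi> w \<in> {of_rat q<..}}"
      by (rule open_pre) simp
    moreover have "v \<in> {w \<in> U. \<phi> w \<in> {of_rat q<..}}" using q(2) uv(2) by simp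
    ultimately obtain w where "w \<in> P q" "w \<in> {w \<in> U. \<phi> w \<in> {of_rat q<..}}"
      by (rule closure_of_meets)
    then show False by (simp add: P_def)
  qed
  show ?thesis
  proof
    show "?B \<subseteq> Field \<tau>" "countable ?B" using Bq by auto
    show "\<phi> v = \<phi> u" if "u \<in> U" "v \<in> U" "\<And>k. k \<in> ?B \<Longrightarrow> v k = u k" for u v
      using not_less[of u v] not_less[of v u] that by (metis linorder_neqE)
  qed
qed

text \<open>The extension is \<open>\<phi> \<circ> r\<close>, where \<open>r\<close> pushes the cube into \<open>U\<close> without changing the
  countably many coordinates that \<open>\<phi>\<close> depends on.\<close>

lemma extend_continuous_real:
  assumes \<tau>: "natLeq <o \<tau>" and U: "openin (cube \<tau>) U" "pushable \<tau> U"
    and \<phi>: "continuous_map (subtopology (cube \<tau>) U) euclideanreal \<phi>"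
  obtains \<psi> where "continuous_map (cube \<tau>) euclideanreal \<psi>"
    "\<And>u. u \<in> U \<Longrightarrow> \<psi> u = \<phi> u" "\<psi> ` topspace (cube \<tau>) \<subseteq> \<phi> ` U"
proof -
  obtain B where B: "B \<subseteq> Field \<tau>" "countable B"
    and det: "\<And>u v. \<lbrakk>u \<in> U; v \<in> U; \<And>k. k \<in> B \<Longrightarrow> v k = u k\<rbrakk> \<Longrightarrow> \<phi> v = \<phi> u"
    using continuous_real_countably_determined[OF U(1) \<phi>] by metis
  obtain r where r: "continuous_map (cube \<tau>) (cube \<tau>) r" "r ` topspace (cube \<tau>) \<subseteq> U"
      "\<And>x k. \<lbrakk>x \<in> topspace (cube \<tau>); k \<in> B\<rbrakk> \<Longrightarrow> r x k = x k"
    using pushableE[OF U(2) B(1) countable_ordLess[OF \<tau> B(2)]] by metis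
  show ?thesis
  proof
    have "continuous_map (cube \<tau>) (subtopology (cube \<tau>) U) r"
      using r by (auto simp: continuous_map_in_subtopology)
    then show "continuous_map (cube \<tau>) euclideanreal (\<phi> \<circ> r)"
      using \<phi> by (rule continuous_map_compose)
    show "(\<phi> \<circ> r) u = \<phi> u" if "u \<in> U" for u
    proof -
      have u: "u \<in> topspace (cube \<tau>)" using that openin_subset[OF U(1)] by blast
      then have "r u \<in> U" using r(2) by blast
      with that have "\<phi> (r u) = \<phi> u" by (rule det) (rule r(3)[OF u])
      then show ?thesis by simp
    qed
    show "(\<phi> \<circ> r) ` topspace (cube \<tau>) \<subseteq> \<phi> ` U" using r(2) by auto
  qed
qed

lemma extend_continuous_cube:
  assumes \<tau>: "natLeq <o \<tau>" and U: "openin (cube \<tau>) U" "pushable \<tau> U"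
    and g: "continuous_map (subtopology (cube \<tau>) U) (cube \<sigma>) g"
  shows "\<exists>h\<in>cmaps (cube \<tau>) (cube \<sigma>). \<forall>u\<in>U. h u = g u"
proof -
  have U_top: "topspace (subtopology (cube \<tau>) U) = U" using openin_subset[OF U(1)] by auto
  have g_top: "g u \<in> topspace (cube \<sigma>)" if "u \<in> U" for u
    using g that U_top by (auto simp: continuous_map_def Pi_iff)
  have "\<exists>\<psi>. continuous_map (cube \<tau>) euclideanreal \<psi> \<and> (\<forall>u\<in>U. \<psi> u = g u k) \<and>
      \<psi> ` topspace (cube \<tau>) \<subseteq> {0..1}" if k: "k \<in> Field \<sigma>" for k
  proof -
    have "continuous_map (subtopology (cube \<tau>) U) euclideanreal (\<lambda>u. g u k)"
      using g k by (simp add: continuous_map_into_cube)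
    moreover have "(\<lambda>u. g u k) ` U \<subseteq> {0..1}"
      using g_top k by (auto simp: topspace_cube PiE_iff)
    ultimately show ?thesis
      using extend_continuous_real[OF \<tau> U, of "\<lambda>u. g u k"] by (metis subset_trans)
  qed
  then have "\<forall>k\<in>Field \<sigma>. \<exists>\<psi>. continuous_map (cube \<tau>) euclideanreal \<psi> \<and>
      (\<forall>u\<in>U. \<psi> u = g u k) \<and> \<psi> ` topspace (cube \<tau>) \<subseteq> {0..1}"
    by simp
  from bchoice[OF this] obtain \<psi> where \<psi>_all: "\<forall>k\<in>Field \<sigma>.
      continuous_map (cube \<tau>) euclideanreal (\<psi> k) \<and>
      (\<forall>u\<in>U. \<psi> k u = g u k) \<and> \<psi> k ` topspace (cube \<tau>) \<subseteq> {0..1}" ..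
  then have \<psi>: "\<And>k. k \<in> Field \<sigma> \<Longrightarrow> continuous_map (cube \<tau>) euclideanreal (\<psi> k)"
      "\<And>k u. \<lbrakk>k \<in> Field \<sigma>; u \<in> U\<rbrakk> \<Longrightarrow> \<psi> k u = g u k"
      "\<And>k. k \<in> Field \<sigma> \<Longrightarrow> \<psi> k ` topspace (cube \<tau>) \<subseteq> {0..1}"
    by simp_all
  define h where "h = restrict (\<lambda>u. restrict (\<lambda>k. \<psi> k u) (Field \<sigma>)) (topspace (cube \<tau>))"
  have "continuous_map (cube \<tau>) (cube \<sigma>) h"
    unfolding continuous_map_into_cube
  proof (intro conjI ballI)
    show "h ` topspace (cube \<tau>) \<subseteq> topspace (cube \<sigma>)"
    proof (rule image_subsetI)
      fix x assume x: "x \<in> topspace (cube \<tau>)"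
      then have "\<psi> k x \<in> {0..1}" if "k \<in> Field \<sigma>" for k using \<psi>(3)[OF that] by blast
      with x show "h x \<in> topspace (cube \<sigma>)"
        unfolding h_def topspace_cube[of \<sigma>] by (simp add: restrict_PiE_iff)
    qed
    show "continuous_map (cube \<tau>) euclideanreal (\<lambda>x. h x k)" if "k \<in> Field \<sigma>" for k
      using \<psi>(1)[OF that] by (rule continuous_map_eq) (simp add: h_def that)
  qed
  moreover have "h u = g u" if "u \<in> U" for u
  proof -
    have "g u \<in> extensional (Field \<sigma>)" using g_top[OF that] by (auto simp: topspace_cube PiE_iff)
    then show ?thesis
      using that U_top \<psi>(2)[OF _ that] by (intro extensionalityI[of _ "Field \<sigma>"]) (auto simp: h_def)
  qed
  ultimately show ?thesis by (auto simp: cmaps_def h_def)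
qed

section \<open>Maps that avoid a \<open>Z\<^sub>\<tau>\<close>-set off a closed set\<close>

text \<open>The image of a push \<open>r0\<close> is compact, so it lies in a finite union of boxes inside \<open>V\<close>.  With \<open>T\<close> the set of
  coordinates of these boxes, only the coordinates in \<open>S = T - B\<close> have to be taken
  from \<open>r0\<close>, and the coordinates in \<open>T\<close> of the result decide that it lies in \<open>V\<close>.\<close>

lemma finitely_witnessed_push:
  assumes V: "openin (cube \<tau>) V" "pushable \<tau> V" and B: "B \<subseteq> Field \<tau>" "|B| <o \<tau>"
  obtains r S T where "continuous_map (cube \<tau>) (cube \<tau>) r"
    "S \<inter> B = {}" "S \<subseteq> T" "T \<subseteq> Field \<tau>" "finite T"
    "\<forall>x\<in>topspace (cube \<tau>). \<forall>k. k \<notin> S \<longrightarrow> r x k = x k"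
    "\<forall>x\<in>topspace (cube \<tau>). \<forall>z\<in>topspace (cube \<tau>). (\<forall>k\<in>T. z k = r x k) \<longrightarrow> z \<in> V"
proof -
  let ?D = "cube \<tau>" and ?L = "lists (Field \<tau> \<times> (UNIV :: (rat \<times> rat) set))"
  obtain r0 where r0: "continuous_map ?D ?D r0" "r0 ` topspace ?D \<subseteq> V"
      "\<And>x k. \<lbrakk>x \<in> topspace ?D; k \<in> B\<rbrakk> \<Longrightarrow> r0 x k = x k"
    using pushableE[OF V(2) B] by metis
  let ?PS = "{ps \<in> ?L. rat_box \<tau> ps \<subseteq> V}"
  have "compactin ?D (r0 ` topspace ?D)"
    using compact_space_cube r0(1) unfolding compact_space_def by (rule image_compactin)
  moreover have "openin ?D W" if "W \<in> rat_box \<tau> ` ?PS" for W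
    using that openin_rat_box by auto
  moreover have "r0 ` topspace ?D \<subseteq> \<Union>(rat_box \<tau> ` ?PS)"
  proof
    fix y assume "y \<in> r0 ` topspace ?D"
    then have "y \<in> V" using r0(2) by blast
    with V(1) obtain ps where "ps \<in> ?L" "y \<in> rat_box \<tau> ps" "rat_box \<tau> ps \<subseteq> V"
      by (rule rat_box_basis)
    then show "y \<in> \<Union>(rat_box \<tau> ` ?PS)" by auto
  qed
  ultimately have "\<exists>\<F>. finite \<F> \<and> \<F> \<subseteq> rat_box \<tau> ` ?PS \<and> r0 ` topspace ?D \<subseteq> \<Union>\<F>"
    by (rule compactinD)
  then obtain \<F> where \<F>: "finite \<F>" "\<F> \<subseteq> rat_box \<tau> ` ?PS" "r0 ` topspace ?D \<subseteq> \<Union>\<F>"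
    by (elim exE conjE)
  obtain PS where PS: "PS \<subseteq> ?PS" "finite PS" "r0 ` topspace ?D \<subseteq> \<Union>(rat_box \<tau> ` PS)"
    using finite_subset_image[OF \<F>(1,2)] \<F>(3) by (elim exE conjE) simp
  define T where "T = (\<Union>ps\<in>PS. fst ` set ps)"
  define S where "S = T - B"
  define r where "r x k = (if k \<in> S then r0 x k else x k)" for x k
  have T: "T \<subseteq> Field \<tau>"
  proof
    fix k assume "k \<in> T"
    then obtain ps p where p: "ps \<in> PS" "p \<in> set ps" "k = fst p" by (auto simp: T_def)
    then have "p \<in> Field \<tau> \<times> UNIV" using PS(1) by (auto simp: in_lists_conv_set)
    then show "k \<in> Field \<tau>" using p(3) by auto
  qed
  have r0_top: "r0 x \<in> topspace ?D" if "x \<in> topspace ?D" for x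
    using that r0(1) by (simp add: continuous_map_def Pi_iff)
  have r_top: "r x \<in> topspace ?D" if "x \<in> topspace ?D" for x
    using that r0_top[OF that] by (simp add: r_def topspace_cube PiE_iff extensional_def)
  show ?thesis
  proof
    show "continuous_map ?D ?D r"
      unfolding continuous_map_into_cube
    proof (intro conjI ballI)
      show "r ` topspace ?D \<subseteq> topspace ?D" using r_top by blast
      fix k assume k: "k \<in> Field \<tau>"
      show "continuous_map ?D euclideanreal (\<lambda>x. r x k)"
      proof (cases "k \<in> S")
        case True
        then show ?thesis using r0(1) k by (simp add: r_def continuous_map_into_cube)
      next
        case False
        then show ?thesis using continuous_map_cube_coord[OF k] by (simp add: r_def)
      qed
    qed
    show "S \<inter> B = {}" "S \<subseteq> T" by (auto simp: S_def)
    show "T \<subseteq> Field \<tau>" "finite T" using T PS(2) by (auto simp: T_def)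
    show "\<forall>x\<in>topspace ?D. \<forall>k. k \<notin> S \<longrightarrow> r x k = x k" by (simp add: r_def)
    show "\<forall>x\<in>topspace ?D. \<forall>z\<in>topspace ?D. (\<forall>k\<in>T. z k = r x k) \<longrightarrow> z \<in> V"
    proof (intro ballI impI)
      fix x z assume x: "x \<in> topspace ?D" and z: "z \<in> topspace ?D" and zr: "\<forall>k\<in>T. z k = r x k"
      obtain ps where ps: "ps \<in> PS" "r0 x \<in> rat_box \<tau> ps" using PS(3) x by blast
      have "r x k = r0 x k" if "k \<in> T" for k
        using that r0(3)[OF x, of k] by (auto simp: r_def S_def)
      then have "z k = r0 x k" if "k \<in> fst ` set ps" for k
        using that zr ps(1) by (auto simp: T_def)
      with ps(2) z have "z \<in> rat_box \<tau> ps" by (rule rat_box_cong)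
      then show "z \<in> V" using PS(1) ps(1) by blast
    qed
  qed
qed

text \<open>One stage of the recursion: on the coordinates in \<open>S\<close>, move linearly from \<open>p\<close> to the pushed
  map with \<open>t\<close> as the parameter.  The set \<open>T\<close> is the certificate for the points with \<open>t u = 1\<close>.\<close>

lemma push_step:
  assumes V: "openin (cube \<tau>) V" "pushable \<tau> V" and B: "B \<subseteq> Field \<tau>" "|B| <o \<tau>"
    and p: "continuous_map Q (cube \<tau>) p"
    and t: "continuous_map Q euclideanreal t" "t ` topspace Q \<subseteq> {0..1}"
  obtains G S T where "continuous_map Q (cube \<tau>) G"
    "S \<inter> B = {}" "S \<subseteq> T" "T \<subseteq> Field \<tau>" "finite T"
    "\<forall>u\<in>topspace Q. \<forall>k. k \<notin> S \<longrightarrow> G u k = p u k"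
    "\<forall>u\<in>topspace Q. t u = 0 \<longrightarrow> G u = p u"
    "\<forall>u\<in>topspace Q. \<forall>z\<in>topspace (cube \<tau>). t u = 1 \<longrightarrow> (\<forall>k\<in>T. z k = G u k) \<longrightarrow> z \<in> V"
proof -
  let ?D = "cube \<tau>"
  obtain r S T where r: "continuous_map ?D ?D r"
    and ST: "S \<inter> B = {}" "S \<subseteq> T" "T \<subseteq> Field \<tau>" "finite T"
    and rS: "\<forall>x\<in>topspace ?D. \<forall>k. k \<notin> S \<longrightarrow> r x k = x k"
    and rV: "\<forall>x\<in>topspace ?D. \<forall>z\<in>topspace ?D. (\<forall>k\<in>T. z k = r x k) \<longrightarrow> z \<in> V"
    by (rule finitely_witnessed_push[OF V B])
  define G where "G u k = (if k \<in> S then (1 - t u) * p u k + t u * r (p u) k else p u k)" for u k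
  have p_top: "p u \<in> topspace ?D" if "u \<in> topspace Q" for u
    using that p by (simp add: continuous_map_def Pi_iff)
  have rp_top: "r (p u) \<in> topspace ?D" if "u \<in> topspace Q" for u
    using p_top[OF that] r by (simp add: continuous_map_def Pi_iff)
  have S_Field: "S \<subseteq> Field \<tau>" using ST(2,3) by blast
  have G_top: "G u \<in> topspace ?D" if u: "u \<in> topspace Q" for u
  proof -
    have "(1 - t u) * p u k + t u * r (p u) k \<in> {0..1}" if "k \<in> Field \<tau>" for k
    proof -
      have "p u k \<in> {0..1}" "r (p u) k \<in> {0..1}" "0 \<le> t u" "t u \<le> 1"
        using p_top[OF u] rp_top[OF u] t(2) u that by (auto simp: topspace_cube PiE_iff)
      then show ?thesis
        using convexD_alt[OF convex_real_interval(5), of "p u k" 0 1 "r (p u) k" "t u"] by simp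
    qed
    then show ?thesis
      using p_top[OF u] S_Field by (auto simp: G_def topspace_cube PiE_iff extensional_def)
  qed
  have G_cont: "continuous_map Q euclideanreal (\<lambda>u. G u k)" if k: "k \<in> Field \<tau>" for k
  proof -
    have "continuous_map Q euclideanreal (\<lambda>u. p u k)"
      using p k by (simp add: continuous_map_into_cube)
    moreover have "continuous_map Q euclideanreal (\<lambda>u. r (p u) k)"
      using continuous_map_compose[OF p r] k by (simp add: continuous_map_into_cube)
    ultimately show ?thesis
      using t(1) unfolding G_def
      by (cases "k \<in> S") (simp_all add: continuous_map_add continuous_map_real_mult continuous_map_diff)
  qed
  show ?thesis
  proof
    show "continuous_map Q ?D G"
      using G_top G_cont by (simp add: continuous_map_into_cube image_subset_iff)
    show "S \<inter> B = {}" "S \<subseteq> T" "T \<subseteq> Field \<tau>" "finite T" by (fact ST)+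
    show "\<forall>u\<in>topspace Q. \<forall>k. k \<notin> S \<longrightarrow> G u k = p u k" by (simp add: G_def)
    show "\<forall>u\<in>topspace Q. t u = 0 \<longrightarrow> G u = p u" by (simp add: G_def fun_eq_iff)
    show "\<forall>u\<in>topspace Q. \<forall>z\<in>topspace ?D. t u = 1 \<longrightarrow> (\<forall>k\<in>T. z k = G u k) \<longrightarrow> z \<in> V"
    proof (intro ballI impI)
      fix u z assume u: "u \<in> topspace Q" "t u = 1" and z: "z \<in> topspace ?D" "\<forall>k\<in>T. z k = G u k"
      have "G u k = r (p u) k" for k
        using rS p_top[OF u(1)] u(2) by (simp add: G_def)
      then show "z \<in> V" using rV p_top[OF u(1)] z by simp
    qed
  qed
qed

text \<open>
  A stage \<open>f b = (G, S, T)\<close> consists of a map, the coordinates it has changed and its certificate.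
  Gluing takes each coordinate from the stage in \<open>A\<close> that has changed it, and from \<open>F\<close> if there is none.
  The stages that matter change disjoint sets of coordinates, so the choice is then unique.
\<close>

definition glue ::
  "('q \<Rightarrow> 'k \<Rightarrow> real) \<Rightarrow> ('a \<Rightarrow> ('q \<Rightarrow> 'k \<Rightarrow> real) \<times> 'k set \<times> 'k set) \<Rightarrow> 'a set \<Rightarrow> 'q \<Rightarrow> 'k \<Rightarrow> real"
  where
  "glue F f A u k =
     (if \<exists>b\<in>A. k \<in> fst (snd (f b))
      then fst (f (SOME b. b \<in> A \<and> k \<in> fst (snd (f b)))) u k else F u k)"

lemma glue_cases:
  obtains "\<And>b. b \<in> A \<Longrightarrow> k \<notin> fst (snd (f b))" "\<And>u. glue F f A u k = F u k"
    | b where "b \<in> A" "k \<in> fst (snd (f b))" "\<And>u. glue F f A u k = fst (f b) u k"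
proof (cases "\<exists>b\<in>A. k \<in> fst (snd (f b))")
  case True
  let ?b = "SOME b. b \<in> A \<and> k \<in> fst (snd (f b))"
  have "?b \<in> A \<and> k \<in> fst (snd (f ?b))"
    by (rule someI_ex) (use True in blast)
  moreover have "glue F f A u k = fst (f ?b) u k" for u using True by (simp add: glue_def)
  ultimately show ?thesis using that(2) by blast
next
  case False
  then have "glue F f A u k = F u k" for u by (simp add: glue_def)
  with False show ?thesis using that(1) by blast
qed

lemma glue_cong:
  assumes "\<And>b. b \<in> A \<Longrightarrow> f b = g b"
  shows "glue F f A = glue F g A"
proof (intro ext)
  fix u k
  have eq: "(b \<in> A \<and> k \<in> fst (snd (f b))) = (b \<in> A \<and> k \<in> fst (snd (g b)))" for b
    using assms by auto
  show "glue F f A u k = glue F g A u k"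
  proof (cases "\<exists>b. b \<in> A \<and> k \<in> fst (snd (f b))")
    case True
    then have "(SOME b. b \<in> A \<and> k \<in> fst (snd (f b))) \<in> A"
      using someI_ex[OF True] by simp
    then show ?thesis using True assms by (simp add: glue_def Bex_def eq)
  next
    case False
    then show ?thesis by (auto simp: glue_def Bex_def eq)
  qed
qed

text \<open>Which stage a coordinate comes from does not depend on the point, so each coordinate of the
  glued map is a coordinate of a continuous map.\<close>

lemma continuous_map_glue:
  assumes F: "continuous_map Q (cube \<tau>) F"
    and f: "\<And>b. b \<in> A \<Longrightarrow> continuous_map Q (cube \<tau>) (fst (f b))"
  shows "continuous_map Q (cube \<tau>) (glue F f A)"
proof -
  have coord: "\<exists>g. continuous_map Q (cube \<tau>) g \<and> (\<forall>u. glue F f A u k = g u k)" for k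
    by (rule glue_cases[of A k f F]) (use F f in blast)+
  show ?thesis
    unfolding continuous_map_into_cube
  proof (intro conjI ballI image_subsetI)
    fix u assume u: "u \<in> topspace Q"
    have "(k \<in> Field \<tau> \<longrightarrow> glue F f A u k \<in> {0..1}) \<and> (k \<notin> Field \<tau> \<longrightarrow> glue F f A u k = undefined)" for k
    proof -
      obtain g where g: "continuous_map Q (cube \<tau>) g" "\<forall>u. glue F f A u k = g u k"
        using coord by blast
      then have "g u \<in> topspace (cube \<tau>)" using u by (simp add: continuous_map_def Pi_iff)
      then show ?thesis using g(2) by (simp add: topspace_cube PiE_iff extensional_def)
    qed
    then show "glue F f A u \<in> topspace (cube \<tau>)"
      by (simp add: topspace_cube PiE_iff extensional_def)
  next
    fix k assume k: "k \<in> Field \<tau>"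
    obtain g where "continuous_map Q (cube \<tau>) g" "\<forall>u. glue F f A u k = g u k"
      using coord by blast
    then show "continuous_map Q euclideanreal (\<lambda>u. glue F f A u k)"
      using k by (simp add: continuous_map_into_cube)
  qed
qed

lemma glue_eq_base:
  assumes "\<And>b. b \<in> A \<Longrightarrow> fst (f b) u = F u"
  shows "glue F f A u = F u"
proof
  fix k show "glue F f A u k = F u k"
    by (rule glue_cases[of A k f F]) (use assms in auto)
qed

text \<open>Stage \<open>a\<close> applies the push along \<open>t a\<close> to the map glued from all earlier stages, with \<open>B\<close> the union of
  the earlier certificates; as these are finite and \<open>a\<close> has fewer than \<open>\<tau>\<close> predecessors, \<open>B\<close> has fewer
  than \<open>\<tau>\<close> elements.  On the certificate of stage \<open>a\<close> the final map equals the map of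
  that stage, because later stages change other coordinates.  So the final map takes the
  points with \<open>t a u = 1\<close> into \<open>V\<close>.\<close>

theorem push_along_functions:
  assumes \<tau>: "Card_order \<tau>" "natLeq <o \<tau>"
    and V: "openin (cube \<tau>) V" "pushable \<tau> V"
    and F: "continuous_map Q (cube \<tau>) F"
    and t: "\<And>a. a \<in> Field \<tau> \<Longrightarrow> continuous_map Q euclideanreal (t a)"
      "\<And>a. a \<in> Field \<tau> \<Longrightarrow> t a ` topspace Q \<subseteq> {0..1}"
  obtains h where "continuous_map Q (cube \<tau>) h"
    "\<And>u. \<lbrakk>u \<in> topspace Q; \<forall>a\<in>Field \<tau>. t a u = 0\<rbrakk> \<Longrightarrow> h u = F u"
    "\<And>u a. \<lbrakk>u \<in> topspace Q; a \<in> Field \<tau>; t a u = 1\<rbrakk> \<Longrightarrow> h u \<in> V"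
proof -
  let ?D = "cube \<tau>"
  \<comment> \<open>What the data \<open>s\<close> of stage \<open>a\<close> must satisfy when \<open>f\<close> holds the data of the earlier stages.\<close>
  define stage where "stage f a s \<longleftrightarrow> (case s of (G, S, T) \<Rightarrow> a \<in> Field \<tau> \<longrightarrow>
      continuous_map Q ?D G \<and> S \<inter> (\<Union>b\<in>underS \<tau> a. snd (snd (f b))) = {} \<and>
      S \<subseteq> T \<and> T \<subseteq> Field \<tau> \<and> finite T \<and>
      (\<forall>u\<in>topspace Q. \<forall>k. k \<notin> S \<longrightarrow> G u k = glue F f (underS \<tau> a) u k) \<and>
      (\<forall>u\<in>topspace Q. t a u = 0 \<longrightarrow> G u = glue F f (underS \<tau> a) u) \<and>
      (\<forall>u\<in>topspace Q. \<forall>z\<in>topspace ?D. t a u = 1 \<longrightarrow> (\<forall>k\<in>T. z k = G u k) \<longrightarrow> z \<in> V))"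
    for f :: "'a \<Rightarrow> ('b \<Rightarrow> 'a \<Rightarrow> real) \<times> 'a set \<times> 'a set" and a s
  have wo: "Well_order \<tau>" using \<tau>(1) card_order_on_well_order_on by blast
  then have wf: "wf (\<tau> - Id)" by (simp add: well_order_on_def)
  have underS_iff: "b \<in> underS \<tau> a \<longleftrightarrow> (b, a) \<in> \<tau> - Id" for a b by (auto simp: underS_def)
  have underS_Field: "b \<in> Field \<tau>" if "b \<in> underS \<tau> a" for a b
    using that by (auto simp: underS_def Field_def)
  have "\<exists>f. \<forall>a. stage f a (f a)"
  proof (rule dependent_wf_choice[OF wf])
    fix f g :: "'a \<Rightarrow> ('b \<Rightarrow> 'a \<Rightarrow> real) \<times> 'a set \<times> 'a set" and a s
    assume "\<And>b. (b, a) \<in> \<tau> - Id \<Longrightarrow> f b = g b"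
    then have fg: "\<And>b. b \<in> underS \<tau> a \<Longrightarrow> f b = g b" by (simp add: underS_iff)
    then have "glue F f (underS \<tau> a) = glue F g (underS \<tau> a)" by (rule glue_cong)
    moreover have "(\<Union>b\<in>underS \<tau> a. snd (snd (f b))) = (\<Union>b\<in>underS \<tau> a. snd (snd (g b)))"
      using fg by simp
    ultimately show "stage f a s = stage g a s" unfolding stage_def by simp
  next
    fix a and f :: "'a \<Rightarrow> ('b \<Rightarrow> 'a \<Rightarrow> real) \<times> 'a set \<times> 'a set"
    assume "\<And>b. (b, a) \<in> \<tau> - Id \<Longrightarrow> stage f b (f b)"
    then have IH: "stage f b (f b)" if "b \<in> underS \<tau> a" for b using that by (simp add: underS_iff)
    have f: "continuous_map Q ?D (fst (f b))" "snd (snd (f b)) \<subseteq> Field \<tau>" "finite (snd (snd (f b)))"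
      if "b \<in> underS \<tau> a" for b
      using IH[OF that] underS_Field[OF that] by (simp_all add: stage_def case_prod_beta)
    show "\<exists>s. stage f a s"
    proof (cases "a \<in> Field \<tau>")
      case False
      then show ?thesis by (simp add: stage_def)
    next
      case True
      let ?B = "\<Union>b\<in>underS \<tau> a. snd (snd (f b))"
      have B: "?B \<subseteq> Field \<tau>" using f(2) by blast
      have card_B: "|?B| <o \<tau>"
        by (rule countable_UN_ordLess[OF \<tau> card_of_underS[OF \<tau>(1) True]])
          (use f(3) countable_finite in blast)
      have p: "continuous_map Q ?D (glue F f (underS \<tau> a))"
        using F f(1) by (rule continuous_map_glue)
      obtain G S T where "continuous_map Q ?D G"
        "S \<inter> ?B = {}" "S \<subseteq> T" "T \<subseteq> Field \<tau>" "finite T"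
        "\<forall>u\<in>topspace Q. \<forall>k. k \<notin> S \<longrightarrow> G u k = glue F f (underS \<tau> a) u k"
        "\<forall>u\<in>topspace Q. t a u = 0 \<longrightarrow> G u = glue F f (underS \<tau> a) u"
        "\<forall>u\<in>topspace Q. \<forall>z\<in>topspace ?D. t a u = 1 \<longrightarrow> (\<forall>k\<in>T. z k = G u k) \<longrightarrow> z \<in> V"
        by (rule push_step[OF V B card_B p t(1)[OF True] t(2)[OF True]])
      then have "stage f a (G, S, T)" by (simp add: stage_def)
      then show ?thesis by blast
    qed
  qed
  then obtain f where f: "\<And>a. stage f a (f a)" by blast
  define G where "G a = fst (f a)" for a
  define S where "S a = fst (snd (f a))" for a
  define T where "T a = snd (snd (f a))" for a
  have st: "continuous_map Q ?D (G a)" "S a \<inter> (\<Union>b\<in>underS \<tau> a. T b) = {}" "S a \<subseteq> T a"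
    "\<And>u k. \<lbrakk>u \<in> topspace Q; k \<notin> S a\<rbrakk> \<Longrightarrow> G a u k = glue F f (underS \<tau> a) u k"
    "\<And>u. \<lbrakk>u \<in> topspace Q; t a u = 0\<rbrakk> \<Longrightarrow> G a u = glue F f (underS \<tau> a) u"
    "\<And>u z. \<lbrakk>u \<in> topspace Q; t a u = 1; z \<in> topspace ?D; \<forall>k\<in>T a. z k = G a u k\<rbrakk> \<Longrightarrow> z \<in> V"
    if "a \<in> Field \<tau>" for a
    using f[of a] that by (simp_all add: stage_def case_prod_beta G_def S_def T_def)
  have comparable: "b = a \<or> b \<in> underS \<tau> a \<or> a \<in> underS \<tau> b"
    if "a \<in> Field \<tau>" "b \<in> Field \<tau>" for a b
    using wo that by (auto simp: underS_def well_order_on_def linear_order_on_def total_on_def)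
  have disj: "S a \<inter> T b = {}" if "a \<in> Field \<tau>" "b \<in> underS \<tau> a" for a b
    using st(2)[OF that(1)] that(2) by blast
  have S_unique: "b = c" if "b \<in> Field \<tau>" "c \<in> Field \<tau>" "k \<in> S b" "k \<in> S c" for b c k
    using comparable[OF that(1,2)] disj[OF that(1), of c] disj[OF that(2), of b]
      st(3)[OF that(1)] st(3)[OF that(2)] that(3,4) by blast
  have glue_at: "glue F f A u k = G b u k" if "A \<subseteq> Field \<tau>" "b \<in> A" "k \<in> S b" for A b u k
  proof (rule glue_cases[of A k f F])
    show ?thesis if "\<And>b. b \<in> A \<Longrightarrow> k \<notin> fst (snd (f b))"
      using that[OF \<open>b \<in> A\<close>] \<open>k \<in> S b\<close> by (simp add: S_def)
    fix c assume c: "c \<in> A" "k \<in> fst (snd (f c))" "\<And>u. glue F f A u k = fst (f c) u k"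
    then have "c = b"
      using that by (intro S_unique[of c b k]) (auto simp: S_def)
    then show ?thesis using c(3) by (simp add: G_def)
  qed
  let ?h = "glue F f (Field \<tau>)"
  have h_cont: "continuous_map Q ?D ?h"
    by (rule continuous_map_glue[OF F]) (use st(1) in \<open>simp add: G_def\<close>)
  have h_T: "?h u k = G a u k" if u: "u \<in> topspace Q" and a: "a \<in> Field \<tau>" and k: "k \<in> T a" for u a k
  proof (rule glue_cases[of "Field \<tau>" k f F])
    assume none: "\<And>b. b \<in> Field \<tau> \<Longrightarrow> k \<notin> fst (snd (f b))" and h: "\<And>u. ?h u k = F u k"
    have "glue F f (underS \<tau> a) u k = F u k"
      using none underS_Field by (auto simp: glue_def)
    then show ?thesis using st(4)[OF a u] none[OF a] h by (simp add: S_def)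
  next
    fix b assume b: "b \<in> Field \<tau>" "k \<in> fst (snd (f b))" "\<And>u. ?h u k = fst (f b) u k"
    then have kb: "k \<in> S b" by (simp add: S_def)
    then have "a \<notin> underS \<tau> b" using disj[OF b(1), of a] k by blast
    then consider "b = a" | "b \<in> underS \<tau> a" using comparable[OF a b(1)] by blast
    then show ?thesis
    proof cases
      case 1
      then show ?thesis using b(3) by (simp add: G_def)
    next
      case 2
      then have "k \<notin> S a" using disj[OF a 2] st(3)[OF b(1)] kb by blast
      then have "G a u k = glue F f (underS \<tau> a) u k" using st(4)[OF a u] by simp
      also have "\<dots> = G b u k" using 2 kb underS_Field by (intro glue_at) auto
      finally show ?thesis using b(3) by (simp add: G_def)
    qed
  qed
  show ?thesis
  proof
    show "continuous_map Q ?D ?h" by (fact h_cont)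
    fix u assume u: "u \<in> topspace Q"
    show "?h u = F u" if zero: "\<forall>a\<in>Field \<tau>. t a u = 0"
    proof -
      have "a \<in> Field \<tau> \<longrightarrow> fst (f a) u = F u" for a
        using wf
      proof (induction a rule: wf_induct_rule)
        case (less a)
        then have "fst (f b) u = F u" if "b \<in> underS \<tau> a" for b
          using that underS_Field[OF that] by (simp add: underS_iff)
        then have "glue F f (underS \<tau> a) u = F u" by (rule glue_eq_base)
        then show ?case using st(5)[of a u] u zero by (simp add: G_def)
      qed
      then show ?thesis by (intro glue_eq_base) simp
    qed
    show "?h u \<in> V" if a: "a \<in> Field \<tau>" "t a u = 1" for a
    proof (rule st(6)[OF a(1) u a(2)])
      show "?h u \<in> topspace ?D" using h_cont u by (simp add: continuous_map_def Pi_iff)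
      show "\<forall>k\<in>T a. ?h u k = G a u k" using h_T[OF u a(1)] by simp
    qed
  qed
qed

text \<open>There are no more than \<open>\<tau>\<close> rational boxes, and those whose closure misses \<open>X\<close> cover the complement
  of \<open>X\<close>; each of them gets an Urysohn function.\<close>

lemma separating_functions:
  assumes \<tau>: "Card_order \<tau>" "natLeq <o \<tau>" and X: "closedin (cube \<tau>) X"
  obtains t where "\<forall>a\<in>Field \<tau>. continuous_map (cube \<tau>) euclideanreal (t a)"
    "\<forall>a\<in>Field \<tau>. t a ` topspace (cube \<tau>) \<subseteq> {0..1}"
    "\<forall>a\<in>Field \<tau>. \<forall>x\<in>X. t a x = 0"
    "\<forall>u\<in>topspace (cube \<tau>) - X. \<exists>a\<in>Field \<tau>. t a u = (1::real)"
proof -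
  let ?D = "cube \<tau>" and ?L = "lists (Field \<tau> \<times> (UNIV :: (rat \<times> rat) set))"
  have inf: "infinite (Field \<tau>)" using \<tau> by (rule infinite_Field)
  have "countable (UNIV :: (rat \<times> rat) set)" by simp
  then have "|UNIV :: (rat \<times> rat) set| \<le>o |UNIV :: nat set|"
    by (metis countableE card_of_ordLeq top_greatest)
  also have "|UNIV :: nat set| \<le>o |Field \<tau>|" using inf by (simp add: infinite_iff_card_of_nat)
  finally have "|Field \<tau> \<times> (UNIV :: (rat \<times> rat) set)| =o |Field \<tau>|"
    using inf by (intro card_of_Times_infinite_simps) auto
  moreover have inf2: "infinite (Field \<tau> \<times> (UNIV :: (rat \<times> rat) set))"
    using inf by (auto simp: finite_cartesian_product_iff)
  ultimately have "|?L| \<le>o |Field \<tau>|"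
    using card_of_lists_ordLeq[OF inf2] ordLeq_ordIso_trans by blast
  moreover have "?L \<noteq> {}" by (metis lists.Nil empty_iff)
  ultimately obtain e where e: "e ` Field \<tau> = ?L"
    using card_of_ordLeq2[of ?L "Field \<tau>"] by blast
  have "\<exists>t. continuous_map ?D euclideanreal t \<and> t ` topspace ?D \<subseteq> {0..1} \<and> (\<forall>x\<in>X. t x = 0) \<and>
      (disjnt X (?D closure_of rat_box \<tau> ps) \<longrightarrow> (\<forall>u\<in>rat_box \<tau> ps. t u = (1::real)))" for ps
  proof (cases "disjnt X (?D closure_of rat_box \<tau> ps)")
    case False
    then show ?thesis by (intro exI[of _ "\<lambda>_. 0"]) auto
  next
    case True
    obtain t where t: "continuous_map ?D (top_of_set {0..1::real}) t" "t ` X \<subseteq> {0}"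
      "t ` (?D closure_of rat_box \<tau> ps) \<subseteq> {1}"
      by (rule Urysohn_lemma[OF normal_space_cube X closedin_closure_of True zero_le_one])
    have sub: "rat_box \<tau> ps \<subseteq> ?D closure_of rat_box \<tau> ps"
      by (rule closure_of_subset) (auto simp: rat_box_def)
    show ?thesis
    proof (intro exI[of _ t] conjI impI ballI)
      show "continuous_map ?D euclideanreal t" "t ` topspace ?D \<subseteq> {0..1}"
        using t(1) by (auto simp: continuous_map_in_subtopology)
      show "t x = 0" if "x \<in> X" for x using t(2) that by blast
      show "t u = 1" if "u \<in> rat_box \<tau> ps" for u using t(3) sub that by blast
    qed
  qed
  from choice[OF allI[OF this]] obtain s where s: "\<forall>ps. continuous_map ?D euclideanreal (s ps) \<and>
      s ps ` topspace ?D \<subseteq> {0..1} \<and> (\<forall>x\<in>X. s ps x = 0) \<and>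
      (disjnt X (?D closure_of rat_box \<tau> ps) \<longrightarrow> (\<forall>u\<in>rat_box \<tau> ps. s ps u = (1::real)))" ..
  show ?thesis
  proof
    show "\<forall>a\<in>Field \<tau>. continuous_map ?D euclideanreal (s (e a))"
      "\<forall>a\<in>Field \<tau>. s (e a) ` topspace ?D \<subseteq> {0..1}"
      "\<forall>a\<in>Field \<tau>. \<forall>x\<in>X. s (e a) x = 0"
      using s by simp_all
    show "\<forall>u\<in>topspace ?D - X. \<exists>a\<in>Field \<tau>. s (e a) u = 1"
    proof
      fix u assume "u \<in> topspace ?D - X"
      then obtain W where W: "openin ?D W" "u \<in> W" "disjnt X (?D closure_of W)"
        using regular_space_cube[of \<tau>] X unfolding regular_space by blast
      from W(1,2) obtain ps where ps: "ps \<in> ?L" "u \<in> rat_box \<tau> ps" "rat_box \<tau> ps \<subseteq> W"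
        by (rule rat_box_basis)
      then have "disjnt X (?D closure_of rat_box \<tau> ps)"
        using W(3) closure_of_mono[of "rat_box \<tau> ps" W ?D] by (auto simp: disjnt_def)
      moreover obtain a where "a \<in> Field \<tau>" "e a = ps" using e ps(1) by (metis imageE)
      ultimately show "\<exists>a\<in>Field \<tau>. s (e a) u = 1" using s ps(2) by blast
    qed
  qed
qed

lemma Tietze_cube:
  assumes X: "closedin (cube \<tau>) X"
    and f: "continuous_map (subtopology (cube \<tau>) X) (cube \<sigma>) f"
  obtains F where "continuous_map (cube \<tau>) (cube \<sigma>) F" "\<forall>x\<in>X. F x = f x"
proof -
  let ?D = "cube \<tau>"
  have X_top: "topspace (subtopology ?D X) = X" using closedin_subset[OF X] by auto
  have f_top: "f x \<in> topspace (cube \<sigma>)" if "x \<in> X" for x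
    using f that X_top by (simp add: continuous_map_def Pi_iff)
  have "\<forall>k\<in>Field \<sigma>. \<exists>\<psi>. continuous_map ?D euclideanreal \<psi> \<and>
      \<psi> ` topspace ?D \<subseteq> {0..1} \<and> (\<forall>x\<in>X. \<psi> x = f x k)"
  proof
    fix k assume k: "k \<in> Field \<sigma>"
    have c: "continuous_map (subtopology ?D X) euclideanreal (\<lambda>x. f x k)"
      using f k by (simp add: continuous_map_into_cube)
    have "(\<lambda>x. f x k) ` X \<subseteq> {0..1}"
      using f_top k by (auto simp: topspace_cube PiE_iff)
    then obtain \<psi> where "continuous_map ?D euclideanreal \<psi>" "\<psi> ` topspace ?D \<subseteq> {0..1}"
      "\<And>x. x \<in> X \<Longrightarrow> \<psi> x = f x k"
      using Tietze_extension_realinterval[OF normal_space_cube X _ _ c, of "{0..1}"]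
      by (auto simp: is_interval_cc)
    then show "\<exists>\<psi>. continuous_map ?D euclideanreal \<psi> \<and>
      \<psi> ` topspace ?D \<subseteq> {0..1} \<and> (\<forall>x\<in>X. \<psi> x = f x k)" by (intro exI[of _ \<psi>]) simp
  qed
  from bchoice[OF this] obtain \<psi> where \<psi>: "\<forall>k\<in>Field \<sigma>. continuous_map ?D euclideanreal (\<psi> k) \<and>
      \<psi> k ` topspace ?D \<subseteq> {0..1} \<and> (\<forall>x\<in>X. \<psi> k x = f x k)" ..
  define F where "F x = restrict (\<lambda>k. \<psi> k x) (Field \<sigma>)" for x
  show ?thesis
  proof
    show "continuous_map ?D (cube \<sigma>) F"
      unfolding continuous_map_into_cube
    proof (intro conjI ballI image_subsetI)
      fix x assume x: "x \<in> topspace ?D"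
      then have "\<psi> k x \<in> {0..1}" if "k \<in> Field \<sigma>" for k using \<psi> that by blast
      then show "F x \<in> topspace (cube \<sigma>)"
        unfolding F_def topspace_cube by (simp add: restrict_PiE_iff)
    next
      fix k assume "k \<in> Field \<sigma>"
      then show "continuous_map ?D euclideanreal (\<lambda>x. F x k)" using \<psi> by (simp add: F_def)
    qed
    show "\<forall>x\<in>X. F x = f x"
    proof
      fix x assume x: "x \<in> X"
      then have "f x \<in> extensional (Field \<sigma>)" using f_top by (simp add: topspace_cube PiE_iff)
      then show "F x = f x"
        by (intro extensionalityI[of _ "Field \<sigma>"]) (use \<psi> x in \<open>simp_all add: F_def\<close>)
    qed
  qed
qed

text \<open>Push a Tietze extension of \<open>f\<close> along functions that vanish on \<open>X\<close> and separate it from all other points.\<close>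

theorem extend_off_Z_set:
  assumes \<tau>: "Card_order \<tau>" "natLeq <o \<tau>" and X: "closedin (cube \<tau>) X"
    and V: "openin (cube \<tau>) V" "pushable \<tau> V"
    and f: "continuous_map (subtopology (cube \<tau>) X) (cube \<tau>) f"
  obtains h where "continuous_map (cube \<tau>) (cube \<tau>) h" "\<forall>x\<in>X. h x = f x"
    "h ` (topspace (cube \<tau>) - X) \<subseteq> V"
proof -
  obtain F where F: "continuous_map (cube \<tau>) (cube \<tau>) F" "\<forall>x\<in>X. F x = f x"
    using X f by (rule Tietze_cube)
  obtain t where t: "\<forall>a\<in>Field \<tau>. continuous_map (cube \<tau>) euclideanreal (t a)"
    "\<forall>a\<in>Field \<tau>. t a ` topspace (cube \<tau>) \<subseteq> {0..1}"
    "\<forall>a\<in>Field \<tau>. \<forall>x\<in>X. t a x = 0"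
    "\<forall>u\<in>topspace (cube \<tau>) - X. \<exists>a\<in>Field \<tau>. t a u = (1::real)"
    using \<tau> X by (rule separating_functions)
  show ?thesis
  proof (rule push_along_functions[OF \<tau> V F(1) t(1)[rule_format] t(2)[rule_format]])
    fix h assume h: "continuous_map (cube \<tau>) (cube \<tau>) h"
      "\<And>u. \<lbrakk>u \<in> topspace (cube \<tau>); \<forall>a\<in>Field \<tau>. t a u = 0\<rbrakk> \<Longrightarrow> h u = F u"
      "\<And>u a. \<lbrakk>u \<in> topspace (cube \<tau>); a \<in> Field \<tau>; t a u = 1\<rbrakk> \<Longrightarrow> h u \<in> V"
    have "\<forall>x\<in>X. h x = f x"
      using h(2) F(2) t(3) closedin_subset[OF X] by (simp add: subset_iff)
    moreover have "h ` (topspace (cube \<tau>) - X) \<subseteq> V"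
    proof (rule image_subsetI)
      fix u assume u: "u \<in> topspace (cube \<tau>) - X"
      then obtain a where "a \<in> Field \<tau>" "t a u = 1" using t(4) by blast
      then show "h u \<in> V" using h(3)[of u a] u by simp
    qed
    ultimately show ?thesis using that[of h] h(1) by simp
  qed
qed

section \<open>Proper maps and their extensions\<close>

lemma cmaps_eq_if_eq_on_dense:
  assumes "Hausdorff_space Y" "f \<in> cmaps X Y" "g \<in> cmaps X Y"
    and "X closure_of U = topspace X" "\<And>u. u \<in> U \<Longrightarrow> f u = g u"
  shows "f = g"
proof (rule extensionalityI[of _ "topspace X"])
  show "f \<in> extensional (topspace X)" "g \<in> extensional (topspace X)"
    using assms by (simp_all add: cmaps_def)
  fix x assume "x \<in> topspace X"
  then have "x \<in> X closure_of U" using assms(4) by simp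
  then show "f x = g x"
    by (rule forall_in_closure_of_eq) (use assms in \<open>auto simp: cmaps_def\<close>)
qed

lemma ext_map_eqI:
  assumes "natLeq <o \<tau>" "pushable \<tau> U" "U \<subseteq> topspace (cube \<tau>)"
    and h: "h \<in> cmaps (cube \<tau>) (cube \<tau>)" "\<And>u. u \<in> U \<Longrightarrow> h u = g u"
  shows "ext_map \<tau> U g = h"
  unfolding ext_map_def
proof (rule the_equality)
  show "h \<in> cmaps (cube \<tau>) (cube \<tau>) \<and> (\<forall>u\<in>U. h u = g u)" using h by simp
  fix h' assume "h' \<in> cmaps (cube \<tau>) (cube \<tau>) \<and> (\<forall>u\<in>U. h' u = g u)"
  then show "h' = h"
    using h by (intro cmaps_eq_if_eq_on_dense[OF Hausdorff_space_cube _ _ pushable_dense[OF assms(1-3)]]) auto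
qed

lemma ext_map_proper:
  assumes \<tau>: "natLeq <o \<tau>" and U: "openin (cube \<tau>) U" "pushable \<tau> U"
    and g: "g \<in> proper_maps \<tau> U V"
  shows "ext_map \<tau> U g \<in> cmaps (cube \<tau>) (cube \<tau>)"
    and "\<And>u. u \<in> U \<Longrightarrow> ext_map \<tau> U g u = g u"
proof -
  have "continuous_map (subtopology (cube \<tau>) U) (cube \<tau>) g"
    using g by (auto simp: proper_maps_def cmaps_def continuous_map_in_subtopology)
  then obtain h where h: "h \<in> cmaps (cube \<tau>) (cube \<tau>)" "\<forall>u\<in>U. h u = g u"
    using extend_continuous_cube[OF \<tau> U] by blast
  then have "ext_map \<tau> U g = h"
    using ext_map_eqI[OF \<tau> U(2) openin_subset[OF U(1)]] by simp
  with h show "ext_map \<tau> U g \<in> cmaps (cube \<tau>) (cube \<tau>)" "\<And>u. u \<in> U \<Longrightarrow> ext_map \<tau> U g u = g u"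
    by simp_all
qed

text \<open>This is where properness enters: if a point \<open>x\<close> outside \<open>U\<close> were sent to a point of \<open>V\<close>, then a compact
  neighbourhood of that point in \<open>V\<close> would have a compact preimage in \<open>U\<close>, which is closed in the cube
  and so stays away from \<open>x\<close>; but \<open>x\<close> is a limit of points of \<open>U\<close> sent into that neighbourhood.\<close>

lemma ext_map_proper_image:
  assumes \<tau>: "natLeq <o \<tau>" and U: "openin (cube \<tau>) U" "pushable \<tau> U"
    and V: "openin (cube \<tau>) V" and g: "g \<in> proper_maps \<tau> U V"
  shows "ext_map \<tau> U g ` (topspace (cube \<tau>) - U) \<subseteq> topspace (cube \<tau>) - V"
proof (rule image_subsetI)
  let ?D = "cube \<tau>" and ?h = "ext_map \<tau> U g"
  fix x assume x: "x \<in> topspace ?D - U"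
  note h = ext_map_proper[OF \<tau> U g]
  have hc: "continuous_map ?D ?D ?h" using h(1) by (simp add: cmaps_def)
  then have hx: "?h x \<in> topspace ?D" using x by (simp add: continuous_map_def Pi_iff)
  moreover have "?h x \<notin> V"
  proof
    assume hxV: "?h x \<in> V"
    have "closedin ?D (topspace ?D - V)" using V by blast
    then obtain W where W: "openin ?D W" "?h x \<in> W" "disjnt (topspace ?D - V) (?D closure_of W)"
      using regular_space_cube[of \<tau>] hx hxV unfolding regular_space by (metis DiffD2 DiffI)
    let ?K = "?D closure_of W"
    have KV: "?K \<subseteq> V" using W(3) closure_of_subset_topspace[of ?D W] by (auto simp: disjnt_def)
    have "compactin ?D ?K" by (simp add: closedin_compact_space compact_space_cube)
    then have "compactin (subtopology ?D V) ?K" using KV by (simp add: compactin_subtopology)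
    then have "compactin (subtopology ?D U) {u \<in> U. g u \<in> ?K}"
      using g by (simp add: proper_maps_def)
    then have "compactin ?D {u \<in> U. g u \<in> ?K}" by (simp add: compactin_subtopology)
    then have closed: "closedin ?D {u \<in> U. g u \<in> ?K}"
      using Hausdorff_space_cube compactin_imp_closedin by blast
    \<comment> \<open>A neighbourhood of \<open>x\<close> that misses this closed part of \<open>U\<close> would, by density of
      \<open>U\<close>, contain a point of \<open>U\<close> sent into \<open>W\<close>.\<close>
    define N where "N = {z \<in> topspace ?D. ?h z \<in> W} \<inter> (topspace ?D - {u \<in> U. g u \<in> ?K})"
    have "openin ?D N"
      unfolding N_def using closed openin_continuous_map_preimage[OF hc W(1)]
      by (intro openin_Int openin_diff) auto
    moreover have "x \<in> N" using x W(2) by (simp add: N_def)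
    moreover have "x \<in> ?D closure_of U"
      using x pushable_dense[OF \<tau> U(2) openin_subset[OF U(1)]] by simp
    ultimately obtain u where u: "u \<in> U" "u \<in> N" by (metis closure_of_meets)
    then have "g u \<in> W" using h(2) by (simp add: N_def)
    moreover have "W \<subseteq> ?K" using W(1) by (simp add: closure_of_subset openin_subset)
    ultimately show False using u by (auto simp: N_def)
  qed
  ultimately show "?h x \<in> topspace ?D - V" by simp
qed

text \<open>The restriction is proper since the preimage of a compact subset of \<open>V\<close> under \<open>h\<close> is closed in the
  cube and contained in \<open>U\<close>.\<close>

lemma restrict_proper_maps:
  assumes h: "continuous_map (cube \<tau>) (cube \<tau>) h"
    and UV: "U \<subseteq> topspace (cube \<tau>)" "openin (cube \<tau>) V"
    and hUV: "h ` U \<subseteq> V" "h ` (topspace (cube \<tau>) - U) \<subseteq> topspace (cube \<tau>) - V"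
  shows "restrict h U \<in> proper_maps \<tau> U V"
proof -
  let ?D = "cube \<tau>"
  have U_top: "topspace (subtopology ?D U) = U" using UV(1) by auto
  have "continuous_map (subtopology ?D U) (subtopology ?D V) h"
    using h hUV(1) by (auto simp: continuous_map_in_subtopology continuous_map_from_subtopology)
  then have "continuous_map (subtopology ?D U) (subtopology ?D V) (restrict h U)"
    by (rule continuous_map_eq) (simp add: U_top)
  moreover have "compactin (subtopology ?D U) {x \<in> U. restrict h U x \<in> K}"
    if K: "compactin (subtopology ?D V) K" for K
  proof -
    have K': "compactin ?D K" "K \<subseteq> V" using K by (simp_all add: compactin_subtopology)
    then have "closedin ?D K" using Hausdorff_space_cube compactin_imp_closedin by blast
    then have "closedin ?D {x \<in> topspace ?D. h x \<in> K}"
      by (rule closedin_continuous_map_preimage[OF h])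
    then have "compactin ?D {x \<in> topspace ?D. h x \<in> K}"
      by (rule closedin_compact_space[OF compact_space_cube])
    moreover have "{x \<in> topspace ?D. h x \<in> K} = {x \<in> U. restrict h U x \<in> K}"
      using K'(2) hUV(2) UV(1) by auto
    ultimately show ?thesis by (simp add: compactin_subtopology)
  qed
  ultimately show ?thesis unfolding proper_maps_def cmaps_def U_top by simp
qed

lemma ext_map_compose:
  assumes \<tau>: "natLeq <o \<tau>" and U: "openin (cube \<tau>) U" "pushable \<tau> U"
    and V: "openin (cube \<tau>) V" "pushable \<tau> V" and W: "openin (cube \<tau>) W"
    and g: "g \<in> proper_maps \<tau> U V" and h: "h \<in> proper_maps \<tau> V W"
  shows "compose U h g \<in> proper_maps \<tau> U W"
    and "ext_map \<tau> U (compose U h g) = compose (topspace (cube \<tau>)) (ext_map \<tau> V h) (ext_map \<tau> U g)"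
proof -
  let ?D = "cube \<tau>" and ?g = "ext_map \<tau> U g" and ?h = "ext_map \<tau> V h"
  note g' = ext_map_proper[OF \<tau> U g] and h' = ext_map_proper[OF \<tau> V h]
  have U_sub: "U \<subseteq> topspace ?D" and V_sub: "V \<subseteq> topspace ?D"
    using U(1) V(1) by (simp_all add: openin_subset)
  have gU: "g u \<in> V" if "u \<in> U" for u
    using g that U_sub by (auto simp: proper_maps_def cmaps_def continuous_map_in_subtopology image_subset_iff)
  have hV: "h v \<in> W" if "v \<in> V" for v
    using h that V_sub by (auto simp: proper_maps_def cmaps_def continuous_map_in_subtopology image_subset_iff)
  let ?c = "compose (topspace ?D) ?h ?g"
  have "continuous_map ?D ?D (?h \<circ> ?g)"
    using g'(1) h'(1) continuous_map_compose[of ?D ?D ?g ?D ?h] by (simp add: cmaps_def)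
  then have c: "continuous_map ?D ?D ?c"
    by (rule continuous_map_eq) (simp add: compose_def)
  have cU: "?c u = compose U h g u" if "u \<in> U" for u
    using that U_sub g'(2) h'(2) gU by (auto simp: compose_def subset_iff)
  have eq: "compose U h g = restrict ?c U"
    using cU by (intro extensionalityI[of _ U]) simp_all
  show "compose U h g \<in> proper_maps \<tau> U W"
    unfolding eq
  proof (rule restrict_proper_maps[OF c U_sub W])
    show "?c ` U \<subseteq> W" using cU gU hV by (auto simp: compose_def)
    show "?c ` (topspace ?D - U) \<subseteq> topspace ?D - W"
      using ext_map_proper_image[OF \<tau> U V(1) g] ext_map_proper_image[OF \<tau> V W h]
      by (simp add: compose_def image_subset_iff)
  qed
  show "ext_map \<tau> U (compose U h g) = ?c"
    by (rule ext_map_eqI[OF \<tau> U(2) U_sub]) (use c cU in \<open>simp_all add: cmaps_def\<close>)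
qed

section \<open>Isomorphisms of categories\<close>

text \<open>The laws of \<open>C\<close> are those of \<open>D\<close>, transported along the bijections of hom-sets;
  in this way it also comes out that \<open>C\<close> is a category.\<close>

lemma category_isomorphismI:
  assumes D: "is_category D"
    and Fo: "bij_betw Fo (cat_obj C) (cat_obj D)"
    and Fm: "\<And>a b. \<lbrakk>a \<in> cat_obj C; b \<in> cat_obj C\<rbrakk> \<Longrightarrow>
      bij_betw (Fm a b) (cat_hom C a b) (cat_hom D (Fo a) (Fo b))"
    and id: "\<And>a. a \<in> cat_obj C \<Longrightarrow> cat_id C a \<in> cat_hom C a a"
      "\<And>a. a \<in> cat_obj C \<Longrightarrow> Fm a a (cat_id C a) = cat_id D (Fo a)"
    and comp: "\<And>a b c f g. \<lbrakk>a \<in> cat_obj C; b \<in> cat_obj C; c \<in> cat_obj C; f \<in> cat_hom C a b; g \<in> cat_hom C b c\<rbrakk>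
        \<Longrightarrow> cat_comp C a b c g f \<in> cat_hom C a c"
      "\<And>a b c f g. \<lbrakk>a \<in> cat_obj C; b \<in> cat_obj C; c \<in> cat_obj C; f \<in> cat_hom C a b; g \<in> cat_hom C b c\<rbrakk>
        \<Longrightarrow> Fm a c (cat_comp C a b c g f) = cat_comp D (Fo a) (Fo b) (Fo c) (Fm b c g) (Fm a b f)"
  shows "is_category_isomorphism C D Fo Fm"
proof -
  have Fo_obj: "Fo a \<in> cat_obj D" if "a \<in> cat_obj C" for a
    using Fo that by (rule bij_betwE[rule_format])
  have Fm_hom: "Fm a b f \<in> cat_hom D (Fo a) (Fo b)"
    if "a \<in> cat_obj C" "b \<in> cat_obj C" "f \<in> cat_hom C a b" for a b f
    using Fm[OF that(1,2)] that(3) by (rule bij_betwE[rule_format])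
  have Fm_inj: "f = g"
    if "a \<in> cat_obj C" "b \<in> cat_obj C" "f \<in> cat_hom C a b" "g \<in> cat_hom C a b" "Fm a b f = Fm a b g" for a b f g
    using bij_betw_imp_inj_on[OF Fm[OF that(1,2)]] that(3-5) by (simp add: inj_on_def)
  have D_unit: "cat_comp D x x y u (cat_id D x) = u" "cat_comp D x y y (cat_id D y) u = u"
    if "x \<in> cat_obj D" "y \<in> cat_obj D" "u \<in> cat_hom D x y" for x y u
    using D that by (simp_all add: is_category_def)
  have D_assoc: "cat_comp D x z w r (cat_comp D x y z q p) = cat_comp D x y w (cat_comp D y z w r q) p"
    if "x \<in> cat_obj D" "y \<in> cat_obj D" "z \<in> cat_obj D" "w \<in> cat_obj D"
      "p \<in> cat_hom D x y" "q \<in> cat_hom D y z" "r \<in> cat_hom D z w" for x y z w p q r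
    using D that unfolding is_category_def by blast
  have D_comp: "cat_comp D x y z q p \<in> cat_hom D x z"
    if "x \<in> cat_obj D" "y \<in> cat_obj D" "z \<in> cat_obj D" "p \<in> cat_hom D x y" "q \<in> cat_hom D y z" for x y z p q
    using D that unfolding is_category_def by blast
  have D_id: "cat_id D x \<in> cat_hom D x x" if "x \<in> cat_obj D" for x
    using D that unfolding is_category_def by blast
  have C: "is_category C"
    unfolding is_category_def
  proof (intro conjI ballI)
    fix a b f assume a: "a \<in> cat_obj C" and b: "b \<in> cat_obj C" and f: "f \<in> cat_hom C a b"
    show "cat_comp C a a b f (cat_id C a) = f"
      by (rule Fm_inj[OF a b]) (simp_all add: a b f id comp D_unit Fo_obj Fm_hom)
    show "cat_comp C a b b (cat_id C b) f = f"
      by (rule Fm_inj[OF a b]) (simp_all add: a b f id comp D_unit Fo_obj Fm_hom)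
  next
    fix a b c d f g h
    assume a: "a \<in> cat_obj C" and b: "b \<in> cat_obj C" and c: "c \<in> cat_obj C" and d: "d \<in> cat_obj C"
      and f: "f \<in> cat_hom C a b" and g: "g \<in> cat_hom C b c" and h: "h \<in> cat_hom C c d"
    have "Fm a d (cat_comp C a c d h (cat_comp C a b c g f)) =
        cat_comp D (Fo a) (Fo c) (Fo d) (Fm c d h) (cat_comp D (Fo a) (Fo b) (Fo c) (Fm b c g) (Fm a b f))"
      by (simp add: a b c d f g h comp)
    also have "\<dots> = cat_comp D (Fo a) (Fo b) (Fo d) (cat_comp D (Fo b) (Fo c) (Fo d) (Fm c d h) (Fm b c g)) (Fm a b f)"
      by (rule D_assoc) (simp_all add: a b c d f g h Fo_obj Fm_hom)
    also have "\<dots> = Fm a d (cat_comp C a b d (cat_comp C b c d h g) f)"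
      by (simp add: a b c d f g h comp)
    finally show "cat_comp C a c d h (cat_comp C a b c g f) = cat_comp C a b d (cat_comp C b c d h g) f"
      by (rule Fm_inj[rotated -1]) (simp_all add: a b c d f g h comp)
  qed (simp_all add: id comp)
  have F: "is_functor C D Fo Fm"
    unfolding is_functor_def using C D by (simp add: Fo_obj Fm_hom id comp)
  define Go where "Go = inv_into (cat_obj C) Fo"
  define Gm where "Gm x y = inv_into (cat_hom C (Go x) (Go y)) (Fm (Go x) (Go y))" for x y
  have Go: "Go x \<in> cat_obj C" "Fo (Go x) = x" if "x \<in> cat_obj D" for x
    using Fo that by (simp_all add: Go_def bij_betw_def inv_into_into f_inv_into_f)
  have GoFo: "Go (Fo a) = a" if "a \<in> cat_obj C" for a
    using Fo that by (simp add: Go_def bij_betw_inv_into_left)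
  have Gm: "Gm x y u \<in> cat_hom C (Go x) (Go y)" "Fm (Go x) (Go y) (Gm x y u) = u"
    if "x \<in> cat_obj D" "y \<in> cat_obj D" "u \<in> cat_hom D x y" for x y u
  proof -
    have "u \<in> Fm (Go x) (Go y) ` cat_hom C (Go x) (Go y)"
      using bij_betw_imp_surj_on[OF Fm[OF Go(1)[OF that(1)] Go(1)[OF that(2)]]] that Go(2) by simp
    then show "Gm x y u \<in> cat_hom C (Go x) (Go y)" "Fm (Go x) (Go y) (Gm x y u) = u"
      unfolding Gm_def by (rule inv_into_into, rule f_inv_into_f)
  qed
  have GmFm: "Gm (Fo a) (Fo b) (Fm a b f) = f"
    if "a \<in> cat_obj C" "b \<in> cat_obj C" "f \<in> cat_hom C a b" for a b f
    using bij_betw_inv_into_left[OF Fm[OF that(1,2)] that(3)] that by (simp add: Gm_def GoFo)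
  have "is_functor D C Go Gm"
    unfolding is_functor_def
  proof (intro conjI ballI C D)
    fix x assume x: "x \<in> cat_obj D"
    show "Go x \<in> cat_obj C" using x by (rule Go)
    show "Gm x x (cat_id D x) = cat_id C (Go x)"
      by (rule Fm_inj[OF Go(1)[OF x] Go(1)[OF x]]) (simp_all add: x Gm D_id id Go)
  next
    fix x y u assume "x \<in> cat_obj D" "y \<in> cat_obj D" "u \<in> cat_hom D x y"
    then show "Gm x y u \<in> cat_hom C (Go x) (Go y)" by (rule Gm)
  next
    fix x y z u v
    assume x: "x \<in> cat_obj D" and y: "y \<in> cat_obj D" and z: "z \<in> cat_obj D"
      and u: "u \<in> cat_hom D x y" and v: "v \<in> cat_hom D y z"
    show "Gm x z (cat_comp D x y z v u) = cat_comp C (Go x) (Go y) (Go z) (Gm y z v) (Gm x y u)"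
    proof (rule Fm_inj[OF Go(1)[OF x] Go(1)[OF z]])
      show "Gm x z (cat_comp D x y z v u) \<in> cat_hom C (Go x) (Go z)"
        by (intro Gm D_comp x y z u v)
      show "cat_comp C (Go x) (Go y) (Go z) (Gm y z v) (Gm x y u) \<in> cat_hom C (Go x) (Go z)"
        by (intro comp(1) Gm(1) Go(1) x y z u v)
      have "Fm (Go x) (Go z) (Gm x z (cat_comp D x y z v u)) = cat_comp D x y z v u"
        by (intro Gm(2) D_comp x y z u v)
      also have "\<dots> = Fm (Go x) (Go z) (cat_comp C (Go x) (Go y) (Go z) (Gm y z v) (Gm x y u))"
        by (subst comp(2)[OF Go(1)[OF x] Go(1)[OF y] Go(1)[OF z] Gm(1)[OF x y u] Gm(1)[OF y z v]])
          (simp add: Go Gm x y z u v)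
      finally show "Fm (Go x) (Go z) (Gm x z (cat_comp D x y z v u)) =
          Fm (Go x) (Go z) (cat_comp C (Go x) (Go y) (Go z) (Gm y z v) (Gm x y u))" .
    qed
  qed
  then show ?thesis
    unfolding is_category_isomorphism_def using F Go GoFo Gm GmFm by blast
qed

section \<open>Proper maps and maps of \<open>Z\<^sub>\<tau>\<close>-sets\<close>

lemma is_category_cat_Z: "is_category (cat_Z \<tau>)"
proof -
  have obj: "topspace (subtopology (cube \<tau>) X) = X" if "Z_set \<tau> (cube \<tau>) X" for X
    using that by (auto simp: Z_set_def dest: closedin_subset)
  have id: "restrict id X \<in> cmaps (subtopology (cube \<tau>) X) (subtopology (cube \<tau>) X)"
    if "Z_set \<tau> (cube \<tau>) X" for X
    using restrict_cmap_id[of "subtopology (cube \<tau>) X"] obj[OF that] by (simp add: cmaps_def)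
  have maps: "f x \<in> Y"
    if "Z_set \<tau> (cube \<tau>) X" "f \<in> cmaps (subtopology (cube \<tau>) X) (subtopology (cube \<tau>) Y)" "x \<in> X"
    for X Y f x
    using that(2,3) obj[OF that(1)] by (auto simp: cmaps_def continuous_map_def Pi_iff)
  have ext: "f \<in> extensional X"
    if "Z_set \<tau> (cube \<tau>) X" "f \<in> cmaps (subtopology (cube \<tau>) X) (subtopology (cube \<tau>) Y)" for X Y f
    using that(2) obj[OF that(1)] by (simp add: cmaps_def)
  have comp: "compose X g f \<in> cmaps (subtopology (cube \<tau>) X) (subtopology (cube \<tau>) Z)"
    if X: "Z_set \<tau> (cube \<tau>) X" and f: "f \<in> cmaps (subtopology (cube \<tau>) X) (subtopology (cube \<tau>) Y)"
      and g: "g \<in> cmaps (subtopology (cube \<tau>) Y) (subtopology (cube \<tau>) Z)" for X Y Z f g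
  proof -
    have "continuous_map (subtopology (cube \<tau>) X) (subtopology (cube \<tau>) Z) (g \<circ> f)"
      using f g continuous_map_compose by (auto simp: cmaps_def)
    then have "continuous_map (subtopology (cube \<tau>) X) (subtopology (cube \<tau>) Z) (compose X g f)"
      by (rule continuous_map_eq) (simp add: obj[OF X] compose_def)
    then show ?thesis using obj[OF X] by (simp add: cmaps_def)
  qed
  show ?thesis
    unfolding is_category_def cat_Z_def cat.simps
  proof (intro conjI ballI)
    fix X assume "X \<in> {X. Z_set \<tau> (cube \<tau>) X}"
    then show "restrict id X \<in> cmaps (subtopology (cube \<tau>) X) (subtopology (cube \<tau>) X)"
      using id by simp
  next
    fix X Y Z f g
    assume "X \<in> {X. Z_set \<tau> (cube \<tau>) X}"
      "f \<in> cmaps (subtopology (cube \<tau>) X) (subtopology (cube \<tau>) Y)"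
      "g \<in> cmaps (subtopology (cube \<tau>) Y) (subtopology (cube \<tau>) Z)"
    then show "compose X g f \<in> cmaps (subtopology (cube \<tau>) X) (subtopology (cube \<tau>) Z)"
      using comp by simp
  next
    fix X Y f
    assume X: "X \<in> {X. Z_set \<tau> (cube \<tau>) X}"
      and f: "f \<in> cmaps (subtopology (cube \<tau>) X) (subtopology (cube \<tau>) Y)"
    show "compose X f (restrict id X) = f"
      using X ext[of X f Y] f by (intro extensionalityI[of _ X]) (simp_all add: compose_def)
    show "compose X (restrict id Y) f = f"
      using X ext[of X f Y] maps[of X f Y] f
      by (intro extensionalityI[of _ X]) (simp_all add: compose_def)
  next
    fix X Y Z W f g h
    assume "X \<in> {X. Z_set \<tau> (cube \<tau>) X}"
      "f \<in> cmaps (subtopology (cube \<tau>) X) (subtopology (cube \<tau>) Y)"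
    then have "f x \<in> Y" if "x \<in> X" for x using maps[of X f Y x] that by simp
    then show "compose X h (compose X g f) = compose X (compose Y h g) f"
      by (intro extensionalityI[of _ X]) (simp_all add: compose_def)
  qed
qed

theorem proposition5p1:
  fixes \<tau> :: "'k rel"
  assumes "Card_order \<tau>" and "natLeq <o \<tau>"
  shows "is_category_isomorphism (cat_Cp \<tau>) (cat_Z \<tau>) (lambda_obj \<tau>) (lambda_mor \<tau>)"
proof (rule category_isomorphismI[OF is_category_cat_Z])
  let ?D = "cube \<tau>" and ?C = "cat_Cp \<tau>" and ?Z = "cat_Z \<tau>"
  note \<tau> = assms
  have obj: "Z_set \<tau> ?D (topspace ?D - U)" "openin ?D U" "pushable \<tau> U" "U \<subseteq> topspace ?D"
    if U: "U \<in> cat_obj ?C" for U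
  proof -
    obtain X where X: "U = topspace ?D - X" "Z_set \<tau> ?D X" using U by (auto simp: cat_Cp_def)
    then have cX: "closedin ?D X" by (simp add: Z_set_def)
    then have "topspace ?D - U = X" using X(1) closedin_subset by auto
    then show "Z_set \<tau> ?D (topspace ?D - U)" using X(2) by simp
    show "openin ?D U" using X(1) cX by blast
    show "pushable \<tau> U" using Z_set_complement_pushable[OF \<tau> X(2)] X(1) by simp
    show "U \<subseteq> topspace ?D" using X(1) by blast
  qed
  have hom: "cat_hom ?C U V = close_class \<tau> U V ` proper_maps \<tau> U V" for U V
    by (simp add: cat_Cp_def)
  have homZ: "cat_hom ?Z (lambda_obj \<tau> U) (lambda_obj \<tau> V) =
      cmaps (subtopology ?D (topspace ?D - U)) (subtopology ?D (topspace ?D - V))" for U V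
    by (simp add: cat_Z_def lambda_obj_def)
  have class_eq: "close_class \<tau> U V g = close_class \<tau> U V g'" if "close \<tau> U g g'" for U V g g'
    using that by (auto simp: close_class_def close_def)
  \<comment> \<open>The extension of a composite is the composite of the extensions, and on the complement
    of \<open>U\<close> it depends only on the closeness classes.\<close>
  have comp_class: "cat_comp ?C U V W (close_class \<tau> V W h) (close_class \<tau> U V g) =
      close_class \<tau> U W (compose U h g)"
    if U: "U \<in> cat_obj ?C" and V: "V \<in> cat_obj ?C" and W: "W \<in> cat_obj ?C"
      and g: "g \<in> proper_maps \<tau> U V" and h: "h \<in> proper_maps \<tau> V W" for U V W g h
  proof -
    have eq: "close_class \<tau> U W (compose U h' g') = close_class \<tau> U W (compose U h g)"
      if h': "h' \<in> close_class \<tau> V W h" and g': "g' \<in> close_class \<tau> U V g" for h' g'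
    proof (rule class_eq)
      have g'p: "g' \<in> proper_maps \<tau> U V" "close \<tau> U g g'"
        and h'p: "h' \<in> proper_maps \<tau> V W" "close \<tau> V h h'"
        using g' h' by (simp_all add: close_class_def)
      show "close \<tau> U (compose U h' g') (compose U h g)"
        unfolding close_def
          ext_map_compose(2)[OF \<tau>(2) obj(2,3)[OF U] obj(2,3)[OF V] obj(2)[OF W] g h]
          ext_map_compose(2)[OF \<tau>(2) obj(2,3)[OF U] obj(2,3)[OF V] obj(2)[OF W] g'p(1) h'p(1)]
      proof
        fix x assume x: "x \<in> topspace ?D - U"
        have "ext_map \<tau> U g x \<in> topspace ?D - V"
          using ext_map_proper_image[OF \<tau>(2) obj(2,3)[OF U] obj(2)[OF V] g] x by blast
        then show "compose (topspace ?D) (ext_map \<tau> V h') (ext_map \<tau> U g') x =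
            compose (topspace ?D) (ext_map \<tau> V h) (ext_map \<tau> U g) x"
          using x g'p(2) h'p(2) by (simp add: compose_def close_def)
      qed
    qed
    have "g \<in> close_class \<tau> U V g" "h \<in> close_class \<tau> V W h"
      using g h by (simp_all add: close_class_def close_def)
    then have "(\<Union>h'\<in>close_class \<tau> V W h. \<Union>g'\<in>close_class \<tau> U V g. close_class \<tau> U W (compose U h' g')) =
        close_class \<tau> U W (compose U h g)"
      using eq by blast
    then show ?thesis by (simp add: cat_Cp_def)
  qed

  show "bij_betw (lambda_obj \<tau>) (cat_obj ?C) (cat_obj ?Z)"
  proof (rule bij_betw_byWitness[of _ "\<lambda>X. topspace ?D - X"])
    show "\<forall>U\<in>cat_obj ?C. topspace ?D - lambda_obj \<tau> U = U"
      using obj(4) by (simp add: lambda_obj_def double_diff)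
    show "\<forall>X\<in>cat_obj ?Z. lambda_obj \<tau> (topspace ?D - X) = X"
      by (simp add: cat_Z_def lambda_obj_complement)
    show "lambda_obj \<tau> ` cat_obj ?C \<subseteq> cat_obj ?Z"
      using obj(1) by (auto simp: lambda_obj_def cat_Z_def)
    show "(\<lambda>X. topspace ?D - X) ` cat_obj ?Z \<subseteq> cat_obj ?C"
      by (auto simp: cat_Z_def cat_Cp_def)
  qed

  show "bij_betw (lambda_mor \<tau> U V) (cat_hom ?C U V) (cat_hom ?Z (lambda_obj \<tau> U) (lambda_obj \<tau> V))"
    if U: "U \<in> cat_obj ?C" and V: "V \<in> cat_obj ?C" for U V
    unfolding hom homZ
  proof (rule bij_betw_imageI)
    let ?X = "topspace ?D - U" and ?Y = "topspace ?D - V"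
    have X_top: "topspace (subtopology ?D ?X) = ?X" by auto
    show "inj_on (lambda_mor \<tau> U V) (close_class \<tau> U V ` proper_maps \<tau> U V)"
    proof (rule inj_onI)
      fix m m' assume "m \<in> close_class \<tau> U V ` proper_maps \<tau> U V" "m' \<in> close_class \<tau> U V ` proper_maps \<tau> U V"
        and eq: "lambda_mor \<tau> U V m = lambda_mor \<tau> U V m'"
      then obtain g g' where g: "g \<in> proper_maps \<tau> U V" "m = close_class \<tau> U V g"
        and g': "g' \<in> proper_maps \<tau> U V" "m' = close_class \<tau> U V g'" by blast
      have "restrict (ext_map \<tau> U g) ?X = restrict (ext_map \<tau> U g') ?X"
        using eq lambda_mor_close_class[OF g(1)] lambda_mor_close_class[OF g'(1)] g(2) g'(2) by simp
      then have "close \<tau> U g g'"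
        unfolding close_def by (metis restrict_apply')
      then show "m = m'" using g(2) g'(2) by (simp add: class_eq)
    qed
    have "lambda_mor \<tau> U V (close_class \<tau> U V g) \<in> cmaps (subtopology ?D ?X) (subtopology ?D ?Y)"
      if g: "g \<in> proper_maps \<tau> U V" for g
    proof -
      have "continuous_map ?D ?D (ext_map \<tau> U g)"
        using ext_map_proper(1)[OF \<tau>(2) obj(2,3)[OF U] g] by (simp add: cmaps_def)
      then have "continuous_map (subtopology ?D ?X) (subtopology ?D ?Y) (ext_map \<tau> U g)"
        using ext_map_proper_image[OF \<tau>(2) obj(2,3)[OF U] obj(2)[OF V] g] X_top
        by (auto simp: continuous_map_in_subtopology continuous_map_from_subtopology)
      then have "continuous_map (subtopology ?D ?X) (subtopology ?D ?Y) (restrict (ext_map \<tau> U g) ?X)"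
        by (rule continuous_map_eq) simp
      then show ?thesis unfolding lambda_mor_close_class[OF g] cmaps_def X_top by simp
    qed
    moreover have "\<exists>g\<in>proper_maps \<tau> U V. lambda_mor \<tau> U V (close_class \<tau> U V g) = f"
      if f: "f \<in> cmaps (subtopology ?D ?X) (subtopology ?D ?Y)" for f
    proof -
      have X_closed: "closedin ?D ?X" using obj(2)[OF U] by blast
      have f_cont: "continuous_map (subtopology ?D ?X) ?D f" and fY: "f ` ?X \<subseteq> ?Y"
        and f_ext: "f \<in> extensional ?X"
        using f X_top by (auto simp: cmaps_def continuous_map_in_subtopology)
      obtain h0 where h0: "continuous_map ?D ?D h0" "\<forall>x\<in>?X. h0 x = f x" "h0 ` (topspace ?D - ?X) \<subseteq> V"
        by (rule extend_off_Z_set[OF \<tau> X_closed obj(2,3)[OF V] f_cont])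
      define h where "h = restrict h0 (topspace ?D)"
      have h_cont: "continuous_map ?D ?D h"
        using h0(1) by (rule continuous_map_eq) (simp add: h_def)
      have hX: "h x = f x" if "x \<in> ?X" for x using h0(2) that by (simp add: h_def)
      have "topspace ?D - ?X = U" using obj(4)[OF U] by blast
      then have hU: "h ` U \<subseteq> V" using h0(3) obj(4)[OF U] by (auto simp: h_def)
      have hXY: "h ` ?X \<subseteq> ?Y" using hX fY by (simp add: image_subset_iff)
      have g: "restrict h U \<in> proper_maps \<tau> U V"
        using h_cont obj(4)[OF U] obj(2)[OF V] hU hXY by (rule restrict_proper_maps)
      have "ext_map \<tau> U (restrict h U) = h"
        by (rule ext_map_eqI[OF \<tau>(2) obj(3,4)[OF U]]) (use h_cont in \<open>simp_all add: cmaps_def h_def\<close>)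
      then have "lambda_mor \<tau> U V (close_class \<tau> U V (restrict h U)) = restrict h ?X"
        using lambda_mor_close_class[OF g] by simp
      also have "\<dots> = f"
        using f_ext hX by (intro extensionalityI[of _ ?X]) simp_all
      finally show ?thesis using g by blast
    qed
    ultimately show "lambda_mor \<tau> U V ` close_class \<tau> U V ` proper_maps \<tau> U V =
        cmaps (subtopology ?D ?X) (subtopology ?D ?Y)"
      by (intro subset_antisym subsetI) (auto simp: image_iff Bex_def, metis)
  qed

  have id_ext: "restrict id U \<in> proper_maps \<tau> U U" "ext_map \<tau> U (restrict id U) = restrict id (topspace ?D)"
    if U: "U \<in> cat_obj ?C" for U
  proof -
    have "restrict (restrict id (topspace ?D)) U \<in> proper_maps \<tau> U U"
      by (rule restrict_proper_maps[OF restrict_cmap_id obj(4)[OF U] obj(2)[OF U]])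
        (use obj(4)[OF U] in auto)
    moreover have "restrict (restrict id (topspace ?D)) U = restrict id U"
      using obj(4)[OF U] by (intro restrict_ext) auto
    ultimately show "restrict id U \<in> proper_maps \<tau> U U" by simp
    show "ext_map \<tau> U (restrict id U) = restrict id (topspace ?D)"
      by (rule ext_map_eqI[OF \<tau>(2) obj(3,4)[OF U]])
        (use restrict_cmap_id[of ?D] obj(4)[OF U] in \<open>auto simp: cmaps_def\<close>)
  qed
  show "cat_id ?C U \<in> cat_hom ?C U U" if "U \<in> cat_obj ?C" for U
    using id_ext(1)[OF that] by (simp add: cat_Cp_def)
  show "lambda_mor \<tau> U U (cat_id ?C U) = cat_id ?Z (lambda_obj \<tau> U)" if U: "U \<in> cat_obj ?C" for U
  proof -
    have "lambda_mor \<tau> U U (cat_id ?C U) = restrict (restrict id (topspace ?D)) (topspace ?D - U)"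
      using lambda_mor_close_class[OF id_ext(1)[OF U]] id_ext(2)[OF U] by (simp add: cat_Cp_def)
    also have "\<dots> = restrict id (topspace ?D - U)" by (rule restrict_ext) simp
    finally show ?thesis by (simp add: cat_Z_def lambda_obj_def)
  qed

  fix U V W m n
  assume U: "U \<in> cat_obj ?C" and V: "V \<in> cat_obj ?C" and W: "W \<in> cat_obj ?C"
    and "m \<in> cat_hom ?C U V" "n \<in> cat_hom ?C V W"
  then obtain g h where g: "g \<in> proper_maps \<tau> U V" "m = close_class \<tau> U V g"
    and h: "h \<in> proper_maps \<tau> V W" "n = close_class \<tau> V W h"
    unfolding hom by blast
  note hg = ext_map_compose[OF \<tau>(2) obj(2,3)[OF U] obj(2,3)[OF V] obj(2)[OF W] g(1) h(1)]
  have nm: "cat_comp ?C U V W n m = close_class \<tau> U W (compose U h g)"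
    unfolding g(2) h(2) by (rule comp_class[OF U V W g(1) h(1)])
  show "cat_comp ?C U V W n m \<in> cat_hom ?C U W"
    unfolding nm hom using hg(1) by blast
  let ?X = "topspace ?D - U" and ?Y = "topspace ?D - V"
  have "lambda_mor \<tau> U W (cat_comp ?C U V W n m) =
      restrict (compose (topspace ?D) (ext_map \<tau> V h) (ext_map \<tau> U g)) ?X"
    unfolding nm lambda_mor_close_class[OF hg(1)] hg(2) ..
  also have "\<dots> = compose ?X (restrict (ext_map \<tau> V h) ?Y) (restrict (ext_map \<tau> U g) ?X)"
  proof (rule extensionalityI[of _ ?X])
    fix x assume x: "x \<in> ?X"
    then have "ext_map \<tau> U g x \<in> ?Y"
      using ext_map_proper_image[OF \<tau>(2) obj(2,3)[OF U] obj(2)[OF V] g(1)] by blast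
    with x show "restrict (compose (topspace ?D) (ext_map \<tau> V h) (ext_map \<tau> U g)) ?X x =
        compose ?X (restrict (ext_map \<tau> V h) ?Y) (restrict (ext_map \<tau> U g) ?X) x"
      by (simp add: compose_def)
  qed simp_all
  also have "\<dots> = cat_comp ?Z (lambda_obj \<tau> U) (lambda_obj \<tau> V) (lambda_obj \<tau> W)
      (lambda_mor \<tau> V W n) (lambda_mor \<tau> U V m)"
    unfolding g(2) h(2) lambda_mor_close_class[OF g(1)] lambda_mor_close_class[OF h(1)]
    by (simp add: cat_Z_def lambda_obj_def)
  finally show "lambda_mor \<tau> U W (cat_comp ?C U V W n m) =
      cat_comp ?Z (lambda_obj \<tau> U) (lambda_obj \<tau> V) (lambda_obj \<tau> W)
        (lambda_mor \<tau> V W n) (lambda_mor \<tau> U V m)" .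
qed

end
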